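(* Let $r=r_1+r_2$, let the subtorus $\mathsf C\subset\mathsf A$ split the framing as $r\to r_1+a\,r_2$, i.e. substitute $(a_1,\dots,a_r)\mapsto(a_1,\dots,a_{r_1},a\,a_{r_1+1},\dots,a\,a_r)$, and let $\tau\in\Lambda[x_1,\dots,x_n]$ be a symmetric polynomial (descendent). Then the bare descendent vertex satisfies $$\lim_{a\to0}V^{(r),(\tau)}(z)=V^{(r_1),(\tau)}\big(z\hbar^{\frac{r_2}{2}}\big)\otimes V^{(r_2),(1)}\big(z\hbar^{-\frac{r_1}{2}}q^{-r_1}\big).$$
   Context: **Setting.** $\mathscr M(n,r)$ is the moduli space of rank $r$ torsion-free sheaves on $\mathbb P^2$ framed along the line at infinity, with $c_2=n$. The torus $\mathsf T=\mathsf A\times(\mathbb C^\times)^2$ acts, with $\mathsf A=(\mathbb C^\times)^r$ scaling the framing with characters $a_1,\dots,a_r$ and $(\mathbb C^\times)^2$ scaling $\mathbb C^2$ with characters $t_1,t_2$; $\hbar=t_1t_2$. The torus $\mathbb C^*_q$ scales the source $\mathbb P^1$ with fixed points $p_1=0$, $p_2=\infty$, and $q$ denotes the character of $T_{p_1}\mathbb P^1$. Put $\mathsf G=\mathsf T\times\mathbb C^*_q$. The bare vertex with descendent $\tau$ is $$V^{(r),(\tau)}(z)=\sum_{d\ge0}\mathrm{ev}_{p_2,*}\big(\mathsf{QM}^d_{p_2}(n,r),\widehat{\mathscr O}_{\mathrm{vir}}\otimes\tau(\mathscr V|_{p_1})\big)z^d\in K_{\mathsf G}(\mathscr M(n,r))_{loc}\otimes\mathbb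 Q[[z]],$$ where $\mathsf{QM}^d_{p_2}(n,r)$ is the moduli space of degree $d$ stable quasimaps $\mathbb P^1\to\mathscr M(n,r)$ nonsingular at $p_2$, $\mathrm{ev}_{p_2}$ is evaluation at $p_2$, $\mathscr V$ is the rank $n$ degree $d$ bundle on $\mathbb P^1$ defining the quasimap, $\tau(\cdot)$ is the virtual $GL(n)$-representation with character $\tau$ applied to a rank $n$ bundle, and $\widehat{\mathscr O}_{\mathrm{vir}}$ is the (symmetrized) virtual structure sheaf, all in the conventions of Okounkov's lectures (arXiv:1512.07363). The pushforward is defined by $\mathsf G$-localization. **Localization formula, with the conventions used.** The $\mathsf T$-fixed points of $\mathscr M(n,r)$ are the $r$-tuples of partitions $\vec\lambda=(\lambda^{(1)},\dots,\lambda^{(r)})$ with $n$ boxes in total; their classes $[\vec\lambda]$ form a basis of localized $K$-theory, and one writes $V^{(r),(\tau)}(z)=\sum_{\vec\lambda}V^{(r),(\tau)}_{\vec\lambda}(z)[\vec\lambda]$. For a box $\Box\in\lambda^{(k)}$ with standard coordinates $(x(\Box),y(\Box))$ (starting from $0$) put $\varphi_{\vec\lambda}(\Box)=a_kt_1^{x(\Box)}t_2^{y(\Box)}$. A degree $\vec d$ assigns an integer $d_\Box\ge0$ to each box of $\vec\lambda$, and $|\vec d|=\sum_\Box d_\Box$; it is required to be stable, meaning that the data $d_\Box$, $\Box\in\lambda^{(i)}$, $i=1,\dots,r$, define $r$ plane partitions. Put $$\mathcal V(\vec\lambda,\vec d)=\sum_{\Box\in\vec\lambda}\varphi_{\vec\lambda}(\Box)q^{d_\Box},\qquad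 \mathcal W=a_1+\cdots+a_r,$$ $$S(\vec\lambda,\vec d)=\mathcal W^*\mathcal V+\mathcal W\mathcal V^*t_1^{-1}t_2^{-1}-\mathcal V^*\mathcal V(1-t_1^{-1})(1-t_2^{-1}),\quad \mathcal V=\mathcal V(\vec\lambda,\vec d),$$ where $*$ inverts all weights. The tangent space has character $T_{\vec\lambda}\mathscr M(n,r)=S(\vec\lambda,\vec0)$, and the virtual tangent space of the quasimap moduli space is given as $$T^{vir}_{(\vec\lambda,\vec d)}=S(\vec\lambda,\vec0)+\frac{S(\vec\lambda,\vec d)-S(\vec\lambda,\vec0)}{q-1}.$$ Let $\hat a$ be defined on Laurent polynomials without constant term by $\hat a(x+y)=\hat a(x)\hat a(y)$ and $\hat a(x)=1/(x^{1/2}-x^{-1/2})$ for a monomial $x$, and let $\tau(\vec\lambda,\vec d)$ be the value of $\tau$ at $x_\Box=\varphi_{\vec\lambda}(\Box)q^{d_\Box}$. Then $$V^{(r),(\tau)}_{\vec\lambda}(z)=\sum_{\vec d\ \text{stable}}\hat a\big(T^{vir}_{(\vec\lambda,\vec d)}\big)\,\tau(\vec\lambda,\vec d)\,(-1)^{r|\vec d|}q^{-\frac{r|\vec d|}2}z^{|\vec d|}.$$ Here $q^{-r|\vec d|/2}$ is the contribution of the polarization to the virtual structure sheaf, and the sign $(-1)^{r|\vec d|}$ is included in the vertex by convention (instead of substituting $z\to(-1)^rz$ in the capping operator). **Meaning of the limit and of the tensor product.** The $\mathsf C$-fixed locus is $\coprod_{n_1+n_2=n}\mathscr M(n_1,r_1)\times\mathscr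 M(n_2,r_2)$. A fixed point $\vec\lambda$ corresponds to the pair $\vec\lambda_1=(\lambda^{(1)},\dots,\lambda^{(r_1)})$, $\vec\lambda_2=(\lambda^{(r_1+1)},\dots,\lambda^{(r)})$, and the theorem is equivalent to the factorization of coefficients, for every $\vec\lambda$ and coefficientwise in $z$, $$\lim_{a\to0}V^{(r),(\tau)}_{\vec\lambda}(z)=V^{(r_1),(\tau)}_{\vec\lambda_1}(z\hbar^{r_2/2})\,V^{(r_2),(1)}_{\vec\lambda_2}(z\hbar^{-r_1/2}q^{-r_1}).$$ In $V^{(r_1),(\tau)}$ the polynomial $\tau$ is evaluated on the $n_1$ boxes of $\vec\lambda_1$, the remaining variables being set to $0$. **Remark on generality.** In full generality $\tau$ can be a symmetric Laurent polynomial in $x_1^{\pm1},\dots,x_n^{\pm1}$; cases with inverse powers of $x_i$ are treated in the same way with $a\to\infty$, the result remaining the same with the roles of $r_1$ and $r_2$ changed.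
   Formalization: The vertex is its localization formula. Each left-hand coefficient is divided by â of the normal space to the C-fixed locus (undivided, the limit is 0 when that space is nonzero), and â, undefined at the trivial weight, which occurs in T^vir, takes an arbitrary nonzero value there. *)

theory Defs
  imports
    "HOL-Analysis.Analysis"
    "HOL-Library.Poly_Mapping"
    "HOL-Combinatorics.Permutations"
    "HOL-Computational_Algebra.Formal_Power_Series"
begin

section \<open>Characters of the torus\<close>

datatype var = Framing nat | T1 | T2 | Q

instantiation var :: linorder
begin

fun var_code :: "var \<Rightarrow> nat" where
  "var_code T1 = 0"
| "var_code T2 = 1"
| "var_code Q = 2"
| "var_code (Framing k) = k + 3"

definition less_eq_var :: "var \<Rightarrow> var \<Rightarrow> bool" where
  "v \<le> w \<longleftrightarrow> var_code v \<le> var_code w"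

definition less_var :: "var \<Rightarrow> var \<Rightarrow> bool" where
  "v < w \<longleftrightarrow> var_code v < var_code w"

instance
proof
  fix v w :: var
  show "v = w" if "v \<le> w" "w \<le> v"
    using that by (cases v; cases w) (auto simp: less_eq_var_def)
qed (auto simp: less_eq_var_def less_var_def)

end

text \<open>
  A weight is a Laurent monomial in the variables, written additively through its exponents.
  A (virtual) character is an integral Laurent polynomial, i.e. an element of the group ring of the
  weight lattice; multiplication of characters is multiplication in this ring.
\<close>

type_synonym weight = "var \<Rightarrow>\<^sub>0 int"
type_synonym character = "weight \<Rightarrow>\<^sub>0 int"

definition weight_pow :: "var \<Rightarrow> int \<Rightarrow> weight" where
  "weight_pow v m = Poly_Mapping.single v m"

definition monomial :: "weight \<Rightarrow> character" where
  "monomial w = Poly_Mapping.single w 1"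

definition dual :: "character \<Rightarrow> character" where
  "dual T = Poly_Mapping.map_key uminus T"


section \<open>Fixed points\<close>

definition is_partition :: "nat list \<Rightarrow> bool" where
  "is_partition p \<longleftrightarrow> sorted_wrt (\<ge>) p \<and> 0 \<notin> set p"

type_synonym box = "nat \<times> nat \<times> nat"

text \<open>The triple \<open>(k, x, y)\<close> is the box with coordinates \<open>(x, y)\<close> of the \<open>k\<close>-th partition.\<close>

definition boxes :: "nat list list \<Rightarrow> box list" where
  "boxes \<mu> = [(k, x, y). k \<leftarrow> [0..<length \<mu>], x \<leftarrow> [0..<length (\<mu> ! k)], y \<leftarrow> [0..<\<mu> ! k ! x]]"

definition fixed_point :: "nat \<Rightarrow> nat \<Rightarrow> nat list list \<Rightarrow> bool" where
  "fixed_point n r \<mu> \<longleftrightarrow>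
     length \<mu> = r \<and> (\<forall>p \<in> set \<mu>. is_partition p) \<and> length (boxes \<mu>) = n"

text \<open>
  Degrees are functions on all triples vanishing off the boxes, so that only finitely many of them
  have a given total degree.  Plane partitions are weakly decreasing in both directions.
\<close>

definition stable :: "nat list list \<Rightarrow> (box \<Rightarrow> nat) \<Rightarrow> bool" where
  "stable \<mu> d \<longleftrightarrow>
     (\<forall>b. b \<notin> set (boxes \<mu>) \<longrightarrow> d b = 0) \<and>
     (\<forall>k x y x' y'. (k, x', y') \<in> set (boxes \<mu>) \<longrightarrow> x \<le> x' \<longrightarrow> y \<le> y' \<longrightarrow>
        d (k, x', y') \<le> d (k, x, y))"

definition total_degree :: "nat list list \<Rightarrow> (box \<Rightarrow> nat) \<Rightarrow> nat" where
  "total_degree \<mu> d = (\<Sum>b\<leftarrow>boxes \<mu>. d b)"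

definition box_weight :: "(box \<Rightarrow> nat) \<Rightarrow> box \<Rightarrow> weight" where
  "box_weight d = (\<lambda>(k, x, y). weight_pow (Framing k) 1 + weight_pow T1 (int x)
      + weight_pow T2 (int y) + weight_pow Q (int (d (k, x, y))))"


section \<open>The virtual tangent space\<close>

definition V_char :: "nat list list \<Rightarrow> (box \<Rightarrow> nat) \<Rightarrow> character" where
  "V_char \<mu> d = (\<Sum>b\<leftarrow>boxes \<mu>. monomial (box_weight d b))"

definition W_char :: "nat list list \<Rightarrow> character" where
  "W_char \<mu> = (\<Sum>k<length \<mu>. monomial (weight_pow (Framing k) 1))"

definition S_char :: "nat list list \<Rightarrow> (box \<Rightarrow> nat) \<Rightarrow> character" where
  "S_char \<mu> d =
     dual (W_char \<mu>) * V_char \<mu> d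
     + W_char \<mu> * dual (V_char \<mu> d) * monomial (weight_pow T1 (-1)) * monomial (weight_pow T2 (-1))
     - dual (V_char \<mu> d) * V_char \<mu> d
         * (1 - monomial (weight_pow T1 (-1))) * (1 - monomial (weight_pow T2 (-1)))"

definition tangent_char :: "nat list list \<Rightarrow> character" where
  "tangent_char \<mu> = S_char \<mu> (\<lambda>_. 0)"

text \<open>The quotient by \<open>q - 1\<close> is exact division in the (integral) ring of Laurent polynomials.\<close>

definition T_vir :: "nat list list \<Rightarrow> (box \<Rightarrow> nat) \<Rightarrow> character" where
  "T_vir \<mu> d = S_char \<mu> (\<lambda>_. 0) +
     (THE X. X * (monomial (weight_pow Q 1) - 1) = S_char \<mu> d - S_char \<mu> (\<lambda>_. 0))"

lemma lookup_dual: "Poly_Mapping.lookup (dual T) w = Poly_Mapping.lookup T (- w)"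
  unfolding dual_def by (simp add: map_key.rep_eq)

lemma dual_zero: "dual 0 = 0"
  by (intro poly_mapping_eqI) (simp add: lookup_dual)

lemma dual_plus: "dual (T + T') = dual T + dual T'"
  by (intro poly_mapping_eqI) (simp add: lookup_dual lookup_add)

lemma dual_monomial: "dual (monomial w) = monomial (- w)"
  by (intro poly_mapping_eqI)
    (auto simp: lookup_dual monomial_def lookup_single when_def minus_equation_iff)

lemma monomial_add: "monomial (v + w) = monomial v * monomial w"
  by (simp add: monomial_def mult_single)

lemma monomial_zero: "monomial 0 = 1"
  by (simp add: monomial_def)

lemma q_minus_1_dvd_pow:
  "(monomial (weight_pow Q 1) - 1) dvd (monomial (weight_pow Q (int m)) - 1)"
proof -
  have "monomial (weight_pow Q (int m)) = monomial (weight_pow Q 1) ^ m"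
  proof (induction m)
    case 0
    show ?case by (simp add: weight_pow_def monomial_zero)
  next
    case (Suc m)
    have "weight_pow Q (int (Suc m)) = weight_pow Q 1 + weight_pow Q (int m)"
      unfolding weight_pow_def single_add[symmetric] by simp
    with Suc show ?case by (simp only: monomial_add power_Suc)
  qed
  moreover have "(x - 1) dvd (x ^ m - 1)" for x :: character
    unfolding power_diff_1_eq[of x m] by (rule dvd_triv_left)
  ultimately show ?thesis by simp
qed

lemma q_minus_1_dvd_pow_neg:
  "(monomial (weight_pow Q 1) - 1) dvd (monomial (weight_pow Q (- int m)) - 1)"
proof -
  have "weight_pow Q (- int m) + weight_pow Q (int m) = 0"
    unfolding weight_pow_def single_add[symmetric] by simp
  then have "monomial (weight_pow Q (- int m)) * monomial (weight_pow Q (int m)) = 1"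
    by (metis monomial_add monomial_zero)
  then have "monomial (weight_pow Q (- int m)) - 1
      = - monomial (weight_pow Q (- int m)) * (monomial (weight_pow Q (int m)) - 1)"
    by (simp add: right_diff_distrib)
  then show ?thesis by (simp only: dvd_mult[OF q_minus_1_dvd_pow])
qed

lemma box_weight_split:
  "box_weight d b = box_weight (\<lambda>_. 0) b + weight_pow Q (int (d b))"
  by (cases b) (simp add: box_weight_def weight_pow_def)

lemma q_minus_1_dvd_V:
  "(monomial (weight_pow Q 1) - 1) dvd (V_char \<mu> d - V_char \<mu> (\<lambda>_. 0))"
proof -
  have *: "(monomial (weight_pow Q 1) - 1)
      dvd (monomial (box_weight d b) - monomial (box_weight (\<lambda>_. 0) b))" for b
  proof -
    have "monomial (box_weight d b) - monomial (box_weight (\<lambda>_. 0) b)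
        = monomial (box_weight (\<lambda>_. 0) b) * (monomial (weight_pow Q (int (d b))) - 1)"
      by (subst box_weight_split) (simp add: monomial_add right_diff_distrib)
    then show ?thesis by (simp only: dvd_mult[OF q_minus_1_dvd_pow])
  qed
  have "(monomial (weight_pow Q 1) - 1) dvd ((\<Sum>b\<leftarrow>bs. monomial (box_weight d b))
      - (\<Sum>b\<leftarrow>bs. monomial (box_weight (\<lambda>_. 0) b)))" for bs
  proof (induction bs)
    case (Cons b bs)
    from dvd_add[OF *[of b] Cons.IH] show ?case by (simp add: algebra_simps)
  qed simp
  then show ?thesis by (simp add: V_char_def)
qed

lemma q_minus_1_dvd_dual_V:
  "(monomial (weight_pow Q 1) - 1) dvd (dual (V_char \<mu> d) - dual (V_char \<mu> (\<lambda>_. 0)))"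
proof -
  have *: "(monomial (weight_pow Q 1) - 1)
      dvd (monomial (- box_weight d b) - monomial (- box_weight (\<lambda>_. 0) b))" for b
  proof -
    have "- box_weight d b = - box_weight (\<lambda>_. 0) b + weight_pow Q (- int (d b))"
      by (subst box_weight_split) (simp add: weight_pow_def single_uminus)
    then have "monomial (- box_weight d b) - monomial (- box_weight (\<lambda>_. 0) b)
        = monomial (- box_weight (\<lambda>_. 0) b) * (monomial (weight_pow Q (- int (d b))) - 1)"
      by (simp only: monomial_add) (simp add: right_diff_distrib)
    then show ?thesis by (simp only: dvd_mult[OF q_minus_1_dvd_pow_neg])
  qed
  have "(monomial (weight_pow Q 1) - 1) dvd (dual (\<Sum>b\<leftarrow>bs. monomial (box_weight d b))
      - dual (\<Sum>b\<leftarrow>bs. monomial (box_weight (\<lambda>_. 0) b)))" for bs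
  proof (induction bs)
    case (Cons b bs)
    from dvd_add[OF *[of b] Cons.IH] show ?case
      by (simp add: dual_plus dual_monomial algebra_simps)
  qed (simp add: dual_zero)
  then show ?thesis by (simp add: V_char_def)
qed

lemma T_vir_unique_quotient:
  "\<exists>!X. X * (monomial (weight_pow Q 1) - 1) = S_char \<mu> d - S_char \<mu> (\<lambda>_. 0)"
proof (rule ex_ex1I)
  let ?q = "monomial (weight_pow Q 1) - 1"
  let ?V = "V_char \<mu> d" and ?Vz = "V_char \<mu> (\<lambda>_. 0)"
  obtain A where A: "?V = ?Vz + ?q * A"
    using q_minus_1_dvd_V[of \<mu> d] unfolding dvd_def diff_eq_eq by (metis add.commute)
  obtain B where B: "dual ?V = dual ?Vz + ?q * B"
    using q_minus_1_dvd_dual_V[of \<mu> d] unfolding dvd_def diff_eq_eq by (metis add.commute)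
  define h where "h = monomial (weight_pow T1 (-1)) * monomial (weight_pow T2 (-1))"
  define e where "e = (1 - monomial (weight_pow T1 (-1))) * (1 - monomial (weight_pow T2 (-1)))"
  have S: "S_char \<mu> d' = dual (W_char \<mu>) * V_char \<mu> d' + W_char \<mu> * dual (V_char \<mu> d') * h
      - dual (V_char \<mu> d') * V_char \<mu> d' * e" for d'
    by (simp add: S_char_def h_def e_def mult.assoc)
  have "S_char \<mu> d - S_char \<mu> (\<lambda>_. 0)
      = (dual (W_char \<mu>) * A + W_char \<mu> * B * h - (dual ?Vz * A + B * ?Vz + ?q * B * A) * e) * ?q"
    unfolding S unfolding B unfolding A by (simp add: algebra_simps)
  then show "\<exists>X. X * ?q = S_char \<mu> d - S_char \<mu> (\<lambda>_. 0)"
    by metis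
  have "weight_pow Q 1 \<noteq> 0"
    by (metis lookup_single_eq lookup_zero one_neq_zero weight_pow_def)
  then have "Poly_Mapping.lookup ?q 0 = -1"
    by (simp add: monomial_def lookup_minus lookup_single lookup_one)
  then have "?q \<noteq> 0" by auto
  then show "X = Y" if "X * ?q = S_char \<mu> d - S_char \<mu> (\<lambda>_. 0)"
      "Y * ?q = S_char \<mu> d - S_char \<mu> (\<lambda>_. 0)" for X Y
    using that by (metis mult_right_cancel)
qed


section \<open>Evaluation at a point of the torus\<close>

text \<open>
  Because of the half-integral powers, a point of (a double cover of) the torus is given by chosen
  square roots: \<open>u v\<close> is a square root of the value of the variable \<open>v\<close>.
  Thus \<open>half_val u w\<close> is the value of \<open>w\<^sup>1\<^sup>/\<^sup>2\<close>, the value of \<open>w\<close> is its square,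
  \<open>\<hbar>\<^sup>1\<^sup>/\<^sup>2\<close> is \<open>u T1 * u T2\<close>, and \<open>q\<^sup>1\<^sup>/\<^sup>2\<close> is \<open>u Q\<close>.
\<close>

definition half_val :: "(var \<Rightarrow> complex) \<Rightarrow> weight \<Rightarrow> complex" where
  "half_val u w = (\<Prod>v \<in> Poly_Mapping.keys w. u v powi Poly_Mapping.lookup w v)"

text \<open>
  Identities of rational functions on the torus are tested at generic points, where no nontrivial
  weight takes the value 1; there no denominator vanishes.
\<close>

definition generic :: "nat \<Rightarrow> (var \<Rightarrow> complex) \<Rightarrow> bool" where
  "generic r u \<longleftrightarrow>
     (let vars = {T1, T2, Q} \<union> Framing ` {..<r} in
       (\<forall>v \<in> vars. u v \<noteq> 0) \<and>
       (\<forall>w. Poly_Mapping.keys w \<subseteq> vars \<longrightarrow> w \<noteq> 0 \<longrightarrow> half_val u w \<noteq> 1))"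

text \<open>
  \<open>\<kappa>\<close> is the value at the trivial weight of a multiplicative extension of \<open>\<hat>a\<close> to
  Laurent polynomials with a constant term; it plays no role for those without one.
\<close>

definition a_hat :: "complex \<Rightarrow> (var \<Rightarrow> complex) \<Rightarrow> character \<Rightarrow> complex" where
  "a_hat \<kappa> u T = (\<Prod>w \<in> Poly_Mapping.keys T.
     (if w = 0 then \<kappa> else 1 / (half_val u w - inverse (half_val u w)))
       powi Poly_Mapping.lookup T w)"


section \<open>Descendents\<close>

text \<open>Polynomials in \<open>x\<^sub>0, x\<^sub>1, \<dots>\<close>, a monomial being given by its exponents.\<close>

type_synonym mpoly = "(nat \<Rightarrow>\<^sub>0 nat) \<Rightarrow>\<^sub>0 complex"

definition symmetric_poly :: "nat \<Rightarrow> mpoly \<Rightarrow> bool" where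
  "symmetric_poly n \<tau> \<longleftrightarrow>
     (\<forall>m \<in> Poly_Mapping.keys \<tau>. Poly_Mapping.keys m \<subseteq> {..<n}) \<and>
     (\<forall>\<pi> m. \<pi> permutes {..<n} \<longrightarrow>
        Poly_Mapping.lookup \<tau> (Poly_Mapping.map_key \<pi> m) = Poly_Mapping.lookup \<tau> m)"

definition eval_poly :: "mpoly \<Rightarrow> (nat \<Rightarrow> complex) \<Rightarrow> complex" where
  "eval_poly \<tau> x = (\<Sum>m \<in> Poly_Mapping.keys \<tau>. Poly_Mapping.lookup \<tau> m *
     (\<Prod>i \<in> Poly_Mapping.keys m. x i ^ Poly_Mapping.lookup m i))"

text \<open>Variables in excess of the number of boxes are set to 0.\<close>

definition descendent_value ::
    "(var \<Rightarrow> complex) \<Rightarrow> mpoly \<Rightarrow> nat list list \<Rightarrow> (box \<Rightarrow> nat) \<Rightarrow> complex" where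
  "descendent_value u \<tau> \<mu> d = eval_poly \<tau>
     (\<lambda>i. if i < length (boxes \<mu>) then half_val u (box_weight d (boxes \<mu> ! i)) ^ 2 else 0)"


section \<open>The bare vertex\<close>

text \<open>
  The coefficient of the bare vertex, given by localization, at a fixed point; the rank is the
  number \<open>length \<mu>\<close> of partitions.
\<close>

definition vertex ::
    "complex \<Rightarrow> (var \<Rightarrow> complex) \<Rightarrow> mpoly \<Rightarrow> nat list list \<Rightarrow> complex fps" where
  "vertex \<kappa> u \<tau> \<mu> = Abs_fps (\<lambda>D. \<Sum>d \<in> {d. stable \<mu> d \<and> total_degree \<mu> d = D}.
     a_hat \<kappa> u (T_vir \<mu> d) * descendent_value u \<tau> \<mu> d *
     (-1) ^ (length \<mu> * D) * u Q powi (- int (length \<mu> * D)))"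

text \<open>The substitution \<open>z \<mapsto> c z\<close>.\<close>

definition rescale :: "complex \<Rightarrow> complex fps \<Rightarrow> complex fps" where
  "rescale c f = fps_compose f (fps_const c * fps_X)"


section \<open>Splitting the framing\<close>

text \<open>
  Multiplies the framing weights from number \<open>r1\<close> on by \<open>a = s\<^sup>2\<close>
  (framing weights are numbered from 0).
\<close>

definition split_framing :: "nat \<Rightarrow> complex \<Rightarrow> (var \<Rightarrow> complex) \<Rightarrow> var \<Rightarrow> complex" where
  "split_framing r1 s u v =
     (case v of Framing k \<Rightarrow> if k < r1 then u v else s * u v | _ \<Rightarrow> u v)"

definition shift_framing :: "nat \<Rightarrow> (var \<Rightarrow> complex) \<Rightarrow> var \<Rightarrow> complex" where
  "shift_framing r1 u v = (case v of Framing k \<Rightarrow> u (Framing (r1 + k)) | _ \<Rightarrow> u v)"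

definition C_degree :: "nat \<Rightarrow> nat \<Rightarrow> weight \<Rightarrow> int" where
  "C_degree r1 r w = (\<Sum>k\<in>{r1..<r}. Poly_Mapping.lookup w (Framing k))"

text \<open>
  The normal space at \<open>\<mu>\<close> to the fixed locus of the splitting one-parameter subgroup, i.e. the
  part of the tangent space on which this subgroup acts nontrivially.

  The classes of the fixed point in the moduli space and in the fixed locus are compared through
  restriction to the fixed locus, symmetrized by the square root of the determinant of the normal
  bundle: it takes the former to the latter divided by \<open>\<hat>a\<close> of the normal space.
\<close>

definition normal_char :: "nat \<Rightarrow> nat list list \<Rightarrow> character" where
  "normal_char r1 \<mu> =
     (\<Sum>w \<in> {w \<in> Poly_Mapping.keys (tangent_char \<mu>). C_degree r1 (length \<mu>) w \<noteq> 0}.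
        Poly_Mapping.single w (Poly_Mapping.lookup (tangent_char \<mu>) w))"

definition restricted_vertex ::
    "complex \<Rightarrow> nat \<Rightarrow> (var \<Rightarrow> complex) \<Rightarrow> mpoly \<Rightarrow> nat list list \<Rightarrow> complex fps" where
  "restricted_vertex \<kappa> r1 u \<tau> \<mu> =
     fps_const (inverse (a_hat \<kappa> u (normal_char r1 \<mu>))) * vertex \<kappa> u \<tau> \<mu>"

end

theory Submission
  imports Defs
begin

text \<open>
  Split \<open>V = V\<^sub>1 + V\<^sub>2\<close> and \<open>W = W\<^sub>1 + W\<^sub>2\<close>.  Then \<open>T\<^sup>v\<^sup>i\<^sup>r\<close> is the sum of the virtual tangent spaces of the
  two factors, of the normal space, and of \<open>M\<^sub>1\<^sub>2 + M\<^sub>2\<^sub>1\<close>, where \<open>M\<^sub>1\<^sub>2\<close> and \<open>M\<^sub>2\<^sub>1\<close> are the changes of the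
  two mixed terms of \<open>S\<close> divided by \<open>q - 1\<close>; they have degree \<open>1\<close> and \<open>-1\<close> in \<open>a\<close>.  The mixed terms
  are exchanged by duality up to \<open>\<hbar>\<^sup>-\<^sup>1\<close>, hence \<open>M\<^sub>2\<^sub>1 = - q\<^sup>-\<^sup>1 \<hbar>\<^sup>-\<^sup>1 M\<^sub>1\<^sub>2\<^sup>*\<close>.  So each weight of \<open>M\<^sub>1\<^sub>2\<close>
  is matched with one of \<open>M\<^sub>2\<^sub>1\<close>, and in the limit such a pair contributes \<open>- (q \<hbar>)\<^sup>-\<^sup>1\<^sup>/\<^sup>2\<close>.  Since
  \<open>M\<^sub>1\<^sub>2\<close> has rank \<open>r\<^sub>1 |d\<^sub>2| - r\<^sub>2 |d\<^sub>1|\<close>, this produces the shifts of \<open>z\<close>.  The descendent loses the boxes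
  of the second factor because their weights tend to 0.
\<close>


section \<open>Characters\<close>

text \<open>Characters form the free abelian group on the weights, so induction over differences
  starting from monomials reaches all of them. Additive identities, and by a nested use bilinear
  ones, then need checking on monomials only.\<close>

lemma char_induct [case_names zero monomial diff]:
  fixes T :: character
  assumes "P 0" "\<And>w. P (monomial w)" "\<And>T T'. P T \<Longrightarrow> P T' \<Longrightarrow> P (T - T')"
  shows "P T"
  using subset_UNIV
  by (induction T rule: frag_induction) (use assms in \<open>simp_all add: monomial_def\<close>)

text \<open>The bound on the support is carried through the induction because quotient rules such as
  \<open>a_hat_diff\<close> hold only under conditions on every weight involved.\<close>

lemma char_induct_keys [consumes 1, case_names zero monomial diff]:
  fixes T :: character
  assumes "Poly_Mapping.keys T \<subseteq> S" "P 0" "\<And>w. w \<in> S \<Longrightarrow> P (monomial w)"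
    "\<And>T T'. Poly_Mapping.keys T \<subseteq> S \<Longrightarrow> Poly_Mapping.keys T' \<subseteq> S \<Longrightarrow> P T \<Longrightarrow> P T' \<Longrightarrow> P (T - T')"
  shows "P T"
proof -
  have "Poly_Mapping.keys T \<subseteq> S \<and> P T"
    using assms(1)
  proof (induction T rule: frag_induction)
    case (diff a b)
    then show ?case using keys_diff[of a b] assms(4) by blast
  qed (use assms in \<open>simp_all add: monomial_def\<close>)
  then show ?thesis ..
qed

lemma dual_diff: "dual (T - T') = dual T - dual T'"
  by (intro poly_mapping_eqI) (simp add: lookup_dual lookup_minus)

lemma dual_mult: "dual (T * T') = dual T * dual T'"
proof (induction T rule: char_induct)
  case (monomial w)
  show ?case
  proof (induction T' rule: char_induct)
    case (monomial w')
    show ?case by (simp add: dual_monomial monomial_add[symmetric])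
  qed (simp_all add: dual_zero dual_diff right_diff_distrib)
qed (simp_all add: dual_zero dual_diff left_diff_distrib)

lemma dual_dual: "dual (dual T) = T"
  by (intro poly_mapping_eqI) (simp add: lookup_dual)

lemma dual_one: "dual 1 = 1"
  using dual_monomial[of 0] by (simp add: monomial_zero)

text \<open>This is the value at the identity of the torus, hence a ring homomorphism to the
  integers that is invariant under \<open>dual\<close>. It counts, with sign, the pairs of weights
  in the limit.\<close>

definition char_rank :: "character \<Rightarrow> int" where
  "char_rank T = (\<Sum>w\<in>Poly_Mapping.keys T. Poly_Mapping.lookup T w)"

lemma char_rank_superset:
  assumes "finite F" "Poly_Mapping.keys T \<subseteq> F"
  shows "char_rank T = (\<Sum>w\<in>F. Poly_Mapping.lookup T w)"
  unfolding char_rank_def using assms by (intro sum.mono_neutral_left) (auto simp: in_keys_iff)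

lemma char_rank_diff: "char_rank (T - T') = char_rank T - char_rank T'"
proof -
  let ?F = "Poly_Mapping.keys T \<union> Poly_Mapping.keys T'"
  show ?thesis
    using keys_diff[of T T']
    by (simp add: char_rank_superset[of ?F] lookup_minus sum_subtractf)
qed

lemma char_rank_zero: "char_rank 0 = 0"
  by (simp add: char_rank_def)

lemma char_rank_uminus: "char_rank (- T) = - char_rank T"
  using char_rank_diff[of 0 T] by (simp add: char_rank_zero)

lemma char_rank_add: "char_rank (T + T') = char_rank T + char_rank T'"
  using char_rank_diff[of T "- T'"] by (simp add: char_rank_uminus)

lemma char_rank_monomial: "char_rank (monomial w) = 1"
  by (simp add: char_rank_def monomial_def)

lemma char_rank_mult: "char_rank (T * T') = char_rank T * char_rank T'"
proof (induction T rule: char_induct)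
  case (monomial w)
  show ?case
  proof (induction T' rule: char_induct)
    case (monomial w')
    show ?case by (simp add: char_rank_monomial monomial_add[symmetric])
  qed (simp_all add: char_rank_zero char_rank_monomial char_rank_diff right_diff_distrib)
qed (simp_all add: char_rank_zero char_rank_diff left_diff_distrib)

lemma char_rank_dual: "char_rank (dual T) = char_rank T"
  by (induction T rule: char_induct) (simp_all add: dual_zero dual_monomial dual_diff char_rank_diff char_rank_monomial)

lemma char_rank_sum: "char_rank (\<Sum>i\<in>I. f i) = (\<Sum>i\<in>I. char_rank (f i))"
  by (induction I rule: infinite_finite_induct) (simp_all add: char_rank_add char_rank_zero)

lemma char_rank_one: "char_rank 1 = 1"
  using char_rank_monomial[of 0] by (simp add: monomial_zero)


section \<open>The virtual tangent space as a bilinear expression\<close>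

definition q_char :: character where
  "q_char = monomial (weight_pow Q 1)"

definition q_inv :: character where
  "q_inv = monomial (weight_pow Q (-1))"

definition hbar_inv :: character where
  "hbar_inv = monomial (weight_pow T1 (-1)) * monomial (weight_pow T2 (-1))"

definition plane_char :: character where
  "plane_char = (1 - monomial (weight_pow T1 (-1))) * (1 - monomial (weight_pow T2 (-1)))"

lemma q_inv_q: "q_inv * q_char = 1"
  unfolding q_inv_def q_char_def
  by (simp add: monomial_add[symmetric] weight_pow_def single_add[symmetric] monomial_zero)

lemma dual_q: "dual q_char = q_inv"
  unfolding q_inv_def q_char_def by (simp add: dual_monomial weight_pow_def single_uminus)

lemma q_minus_1_nonzero: "q_char - 1 \<noteq> 0"
proof -
  have "weight_pow Q 1 \<noteq> 0"
    by (metis lookup_single_eq lookup_zero one_neq_zero weight_pow_def)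
  then have "Poly_Mapping.lookup (q_char - 1) 0 = -1"
    by (simp add: q_char_def monomial_def lookup_minus lookup_single lookup_one)
  then show ?thesis by auto
qed

text \<open>Multiplying \<open>1 - t\<close> by the inverse of \<open>t\<close> gives
  \<open>-(1 - 1/t)\<close>; the signs from the two coordinates cancel.\<close>

lemma dual_hbar_inv_plane: "dual plane_char * hbar_inv = plane_char"
proof -
  have u: "monomial (weight_pow v 1) * monomial (weight_pow v (-1)) = 1" for v
    by (simp add: monomial_add[symmetric] weight_pow_def single_add[symmetric] monomial_zero)
  have d: "dual (monomial (weight_pow v (-1))) = monomial (weight_pow v 1)" for v
    by (simp add: dual_monomial weight_pow_def single_uminus)
  have *: "(1 - x) * (1 - y) * (x' * y') = (1 - x') * (1 - y')"
    if "x * x' = 1" "y * y' = 1" for x x' y y' :: character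
  proof -
    have "(1 - x) * (1 - y) * (x' * y') = (x' - x * x') * (y' - y * y')"
      by (simp add: algebra_simps)
    then show ?thesis unfolding that by (simp add: algebra_simps)
  qed
  show ?thesis
    unfolding plane_char_def hbar_inv_def dual_mult dual_diff dual_one d
    by (rule *) (rule u)+
qed

lemma dual_hbar_inv: "dual hbar_inv * hbar_inv = 1"
  by (simp add: hbar_inv_def dual_mult dual_monomial monomial_add[symmetric] weight_pow_def
      single_uminus monomial_zero)

text \<open>
  The summand of \<open>S\<close> pairing the framing and tautological parts \<open>(W, V)\<close> of one factor with
  the parts \<open>(W', V')\<close> of another one.
\<close>

definition S_pair :: "character \<Rightarrow> character \<Rightarrow> character \<Rightarrow> character \<Rightarrow> character" where
  "S_pair W V W' V' = dual W * V' + W' * dual V * hbar_inv - dual V * V' * plane_char"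

lemma S_char_eq: "S_char \<mu> d = S_pair (W_char \<mu>) (V_char \<mu> d) (W_char \<mu>) (V_char \<mu> d)"
  by (simp add: S_char_def S_pair_def hbar_inv_def plane_char_def mult.assoc)

lemma S_pair_add:
  "S_pair (W1 + W2) (V1 + V2) (W1 + W2) (V1 + V2)
    = S_pair W1 V1 W1 V1 + S_pair W2 V2 W2 V2 + (S_pair W1 V1 W2 V2 + S_pair W2 V2 W1 V1)"
  by (simp add: S_pair_def dual_plus algebra_simps)

text \<open>Duality followed by \<open>hbar_inv\<close> exchanges the two framing terms and
  preserves the quadratic one by \<open>dual_hbar_inv_plane\<close>. On the tangent space this
  reflects the symplectic form of weight \<open>hbar\<close>.\<close>

lemma S_pair_swap: "S_pair W' V' W V = dual (S_pair W V W' V') * hbar_inv"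
proof -
  have "dual (S_pair W V W' V') * hbar_inv = W * dual V' * hbar_inv
      + dual W' * V * (dual hbar_inv * hbar_inv)
      - V * dual V' * (dual plane_char * hbar_inv)"
    unfolding S_pair_def dual_plus dual_diff dual_mult dual_dual by (simp add: algebra_simps)
  then show ?thesis
    unfolding dual_hbar_inv dual_hbar_inv_plane by (simp add: S_pair_def mult.commute)
qed

text \<open>
  The quotient by \<open>q - 1\<close> of the change of \<open>S_pair\<close> when \<open>V\<close> and \<open>V'\<close> change by
  \<open>(q - 1) A\<close> and \<open>(q - 1) A'\<close>; the dual of \<open>(q - 1) A\<close> is \<open>- (q - 1) q\<^sup>-\<^sup>1 A\<^sup>*\<close>.
\<close>

definition S_quot ::
    "character \<Rightarrow> character \<Rightarrow> character \<Rightarrow> character \<Rightarrow> character \<Rightarrow> character \<Rightarrow> character" where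
  "S_quot W V A W' V' A' = dual W * A' - W' * (q_inv * dual A) * hbar_inv
     - (dual V * A' - q_inv * dual A * V' - (q_char - 1) * (q_inv * dual A) * A') * plane_char"

lemma dual_q_minus_1: "dual ((q_char - 1) * A) = - ((q_char - 1) * (q_inv * dual A))"
proof -
  have "(q_char - 1) * (q_inv * dual A) = (q_inv * q_char - q_inv) * dual A"
    by (simp add: algebra_simps)
  then show ?thesis
    unfolding q_inv_q dual_mult dual_diff dual_one dual_q by (simp add: algebra_simps)
qed

text \<open>In the product of \<open>dual V\<close> and \<open>V'\<close> both factors change, and
  the product of the two increments contains \<open>q_char - 1\<close> twice. One copy survives the
  division, in the last term inside the parentheses of \<open>S_quot\<close>.\<close>

lemma S_quot:
  "S_quot W V A W' V' A' * (q_char - 1)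
    = S_pair W (V + (q_char - 1) * A) W' (V' + (q_char - 1) * A') - S_pair W V W' V'"
  unfolding S_pair_def dual_plus dual_q_minus_1 S_quot_def by (simp add: algebra_simps)

text \<open>After multiplication by \<open>q_char - 1\<close> this is \<open>S_pair_swap\<close> for
  the old and the new data. Dualizing that factor produces the sign and \<open>q_inv\<close>, and
  the factor cancels because it is nonzero in an integral domain.\<close>

lemma S_quot_swap:
  "S_quot W' V' A' W V A = - (dual (S_quot W V A W' V' A') * (q_inv * hbar_inv))"
proof -
  let ?M = "S_quot W V A W' V' A'"
  have "S_quot W' V' A' W V A * (q_char - 1) = dual (?M * (q_char - 1)) * hbar_inv"
    by (simp only: S_quot dual_diff left_diff_distrib[where c = hbar_inv] S_pair_swap[of W' V' W V, symmetric]
      S_pair_swap[of W' "V' + (q_char - 1) * A'" W "V + (q_char - 1) * A", symmetric])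
  also have "\<dots> = - (dual ?M * (q_inv * hbar_inv)) * (q_char - 1)"
    unfolding mult.commute[of ?M] dual_q_minus_1 by (simp add: algebra_simps)
  finally show ?thesis
    using q_minus_1_nonzero mult_right_cancel by blast
qed

lemma S_quot_add:
  "S_quot (W1 + W2) (V1 + V2) (A1 + A2) (W1 + W2) (V1 + V2) (A1 + A2)
    = S_quot W1 V1 A1 W1 V1 A1 + S_quot W2 V2 A2 W2 V2 A2
      + (S_quot W1 V1 A1 W2 V2 A2 + S_quot W2 V2 A2 W1 V1 A1)"
  by (simp add: S_quot_def dual_plus algebra_simps)

text \<open>\<open>plane_char\<close> has rank 0, so only the two framing terms contribute.\<close>

lemma char_rank_S_quot: "char_rank (S_quot W V A W' V' A') = char_rank W * char_rank A' - char_rank W' * char_rank A"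
  by (simp add: S_quot_def char_rank_diff char_rank_mult char_rank_dual q_inv_def hbar_inv_def plane_char_def
      char_rank_monomial char_rank_one)

section \<open>Explicit form of the virtual tangent space\<close>

lemma T_vir_eqI:
  assumes "X * (q_char - 1) = S_char \<mu> d - S_char \<mu> (\<lambda>_. 0)"
  shows "T_vir \<mu> d = tangent_char \<mu> + X"
  unfolding T_vir_def tangent_char_def
  by (subst the1_equality[OF T_vir_unique_quotient assms[unfolded q_char_def]]) (rule refl)

definition box_char :: "(box \<Rightarrow> nat) \<Rightarrow> box list \<Rightarrow> character" where
  "box_char d bs = (\<Sum>b\<leftarrow>bs. monomial (box_weight d b))"

text \<open>The geometric sum is \<open>(q^m - 1) / (q - 1)\<close> for \<open>m = d b\<close>, so
  this is the change of the tautological character divided by \<open>q - 1\<close>, with no division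
  left.\<close>

definition box_quot :: "(box \<Rightarrow> nat) \<Rightarrow> box list \<Rightarrow> character" where
  "box_quot d bs = (\<Sum>b\<leftarrow>bs. monomial (box_weight (\<lambda>_. 0) b) * (\<Sum>i<d b. q_char ^ i))"

lemma V_char_eq: "V_char \<mu> d = box_char d (boxes \<mu>)"
  by (simp add: V_char_def box_char_def)

lemma q_char_power: "monomial (weight_pow Q (int m)) = q_char ^ m"
proof (induction m)
  case (Suc m)
  have "weight_pow Q (int (Suc m)) = weight_pow Q 1 + weight_pow Q (int m)"
    unfolding weight_pow_def single_add[symmetric] by simp
  with Suc show ?case by (simp only: monomial_add power_Suc q_char_def)
qed (simp add: weight_pow_def monomial_zero)

lemma box_char_eq: "box_char d bs = box_char (\<lambda>_. 0) bs + (q_char - 1) * box_quot d bs"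
proof (induction bs)
  case (Cons b bs)
  have "monomial (box_weight d b) = monomial (box_weight (\<lambda>_. 0) b) * q_char ^ d b"
    by (subst box_weight_split) (simp add: monomial_add q_char_power)
  also have "q_char ^ d b = 1 + (q_char - 1) * (\<Sum>i<d b. q_char ^ i)"
    using power_diff_1_eq[of q_char "d b"] by (simp add: algebra_simps)
  finally show ?case
    using Cons by (simp add: box_char_def box_quot_def algebra_simps)
qed (simp add: box_char_def box_quot_def)

lemma char_rank_box_quot: "char_rank (box_quot d bs) = int (\<Sum>b\<leftarrow>bs. d b)"
proof -
  have "char_rank (q_char ^ i) = 1" for i
    by (simp add: q_char_power[symmetric] char_rank_monomial)
  then show ?thesis
    by (induction bs)
      (simp_all add: box_quot_def char_rank_add char_rank_zero char_rank_mult char_rank_monomial char_rank_sum)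
qed

text \<open>Both summands are additive in the data of each of their two slots, so a splitting of the
  framing splits \<open>T_vir\<close> into two diagonal and two mixed parts.\<close>

lemma T_vir_eq_S_quot:
  "T_vir \<mu> d = S_pair (W_char \<mu>) (V_char \<mu> (\<lambda>_. 0)) (W_char \<mu>) (V_char \<mu> (\<lambda>_. 0))
     + S_quot (W_char \<mu>) (V_char \<mu> (\<lambda>_. 0)) (box_quot d (boxes \<mu>))
         (W_char \<mu>) (V_char \<mu> (\<lambda>_. 0)) (box_quot d (boxes \<mu>))"
proof -
  have "T_vir \<mu> d = tangent_char \<mu> + S_quot (W_char \<mu>) (V_char \<mu> (\<lambda>_. 0)) (box_quot d (boxes \<mu>))
         (W_char \<mu>) (V_char \<mu> (\<lambda>_. 0)) (box_quot d (boxes \<mu>))"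
    by (rule T_vir_eqI) (simp only: S_quot S_char_eq V_char_eq box_char_eq[of d])
  then show ?thesis by (simp add: tangent_char_def S_char_eq)
qed


section \<open>Grading by the splitting subgroup\<close>

text \<open>Besides the degree in \<open>a\<close>, the variables that occur are recorded:
  genericity applies to weights in \<open>vars r\<close>, and renumbering the second factor requires
  that no framing below \<open>r1\<close> occurs.\<close>

definition graded :: "nat \<Rightarrow> nat \<Rightarrow> var set \<Rightarrow> int \<Rightarrow> character \<Rightarrow> bool" where
  "graded r1 r X c T \<longleftrightarrow>
     (\<forall>w\<in>Poly_Mapping.keys T. Poly_Mapping.keys w \<subseteq> X \<and> C_degree r1 r w = c)"

lemma C_degree_add: "C_degree r1 r (v + w) = C_degree r1 r v + C_degree r1 r w"
  by (simp add: C_degree_def lookup_add sum.distrib)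

lemma C_degree_uminus: "C_degree r1 r (- w) = - C_degree r1 r w"
  by (simp add: C_degree_def sum_negf)

lemma C_degree_zero: "C_degree r1 r 0 = 0"
  by (simp add: C_degree_def)

lemma C_degree_weight_pow:
  "C_degree r1 r (weight_pow v m) = (if v \<in> Framing ` {r1..<r} then m else 0)"
proof (cases v)
  case (Framing k)
  then show ?thesis
    by (auto simp: C_degree_def weight_pow_def lookup_single when_def image_iff)
qed (auto simp: C_degree_def weight_pow_def lookup_single)

lemma keys_weight_pow: "Poly_Mapping.keys (weight_pow v m) \<subseteq> {v}"
  by (simp add: weight_pow_def)

lemma graded_mono: "graded r1 r X c T \<Longrightarrow> X \<subseteq> Y \<Longrightarrow> graded r1 r Y c T"
  unfolding graded_def by blast

lemma graded_zero: "graded r1 r X c 0"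
  by (simp add: graded_def)

lemma graded_one: "graded r1 r X 0 1"
  by (simp add: graded_def C_degree_zero)

lemma graded_add: "graded r1 r X c T \<Longrightarrow> graded r1 r X c T' \<Longrightarrow> graded r1 r X c (T + T')"
  using keys_add[of T T'] unfolding graded_def by blast

lemma graded_diff: "graded r1 r X c T \<Longrightarrow> graded r1 r X c T' \<Longrightarrow> graded r1 r X c (T - T')"
  using keys_diff[of T T'] unfolding graded_def by blast

lemma graded_mult:
  assumes "graded r1 r X c T" "graded r1 r X c' T'" "c'' = c + c'"
  shows "graded r1 r X c'' (T * T')"
  unfolding graded_def
proof (intro ballI)
  fix w assume "w \<in> Poly_Mapping.keys (T * T')"
  then obtain a b where w: "w = a + b" "a \<in> Poly_Mapping.keys T" "b \<in> Poly_Mapping.keys T'"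
    using keys_mult[of T T'] by blast
  show "Poly_Mapping.keys w \<subseteq> X \<and> C_degree r1 r w = c''"
    using assms w subset_trans[OF keys_add[of a b]] unfolding graded_def by (simp add: C_degree_add)
qed

lemma graded_monomial:
  "Poly_Mapping.keys w \<subseteq> X \<Longrightarrow> C_degree r1 r w = c \<Longrightarrow> graded r1 r X c (monomial w)"
  by (simp add: graded_def monomial_def)

lemma graded_weight_pow:
  "v \<in> X \<Longrightarrow> c = (if v \<in> Framing ` {r1..<r} then m else 0) \<Longrightarrow>
    graded r1 r X c (monomial (weight_pow v m))"
  using keys_weight_pow[of v m] by (intro graded_monomial) (auto simp: C_degree_weight_pow)

lemma keys_dual: "Poly_Mapping.keys (dual T) = uminus ` Poly_Mapping.keys T"
proof -
  have "w \<in> Poly_Mapping.keys (dual T) \<longleftrightarrow> - w \<in> Poly_Mapping.keys T" for w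
    by (simp add: in_keys_iff lookup_dual)
  moreover have "w \<in> uminus ` Poly_Mapping.keys T \<longleftrightarrow> - w \<in> Poly_Mapping.keys T" for w
    using image_eqI[of w uminus "- w" "Poly_Mapping.keys T"] by auto
  ultimately show ?thesis by blast
qed

lemma graded_dual: "graded r1 r X c T \<Longrightarrow> c' = - c \<Longrightarrow> graded r1 r X c' (dual T)"
  by (auto simp: graded_def keys_dual C_degree_uminus)

lemma graded_sum: "(\<And>i. i \<in> I \<Longrightarrow> graded r1 r X c (f i)) \<Longrightarrow> graded r1 r X c (\<Sum>i\<in>I. f i)"
  by (induction I rule: infinite_finite_induct) (auto simp: graded_zero intro: graded_add)

lemma graded_sum_list:
  "(\<And>i. i \<in> set xs \<Longrightarrow> graded r1 r X c (f i)) \<Longrightarrow> graded r1 r X c (\<Sum>i\<leftarrow>xs. f i)"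
  by (induction xs) (auto simp: graded_zero intro: graded_add)

lemma graded_power: "graded r1 r X 0 T \<Longrightarrow> graded r1 r X 0 (T ^ n)"
  by (induction n) (auto simp: graded_one intro: graded_mult)

lemma graded_q: "Q \<in> X \<Longrightarrow> graded r1 r X 0 q_char" "Q \<in> X \<Longrightarrow> graded r1 r X 0 q_inv"
  by (auto simp: q_char_def q_inv_def intro: graded_weight_pow)

lemma graded_plane:
  assumes "T1 \<in> X" "T2 \<in> X"
  shows "graded r1 r X 0 hbar_inv" "graded r1 r X 0 plane_char"
  using assms unfolding hbar_inv_def plane_char_def
  by (auto intro!: graded_mult[where c = 0 and c' = 0] graded_diff graded_one graded_weight_pow)

text \<open>\<open>dual\<close> negates degrees, and \<open>hbar_inv\<close> and
  \<open>plane_char\<close> have degree 0. Hence the diagonal terms have degree 0 and the mixed ones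
  opposite degrees.\<close>

lemma graded_S_pair:
  assumes "{T1, T2, Q} \<subseteq> X" "graded r1 r X c W" "graded r1 r X c V"
    "graded r1 r X c' W'" "graded r1 r X c' V'"
  shows "graded r1 r X (c' - c) (S_pair W V W' V')"
proof -
  have d: "graded r1 r X (- c) (dual W)" "graded r1 r X (- c) (dual V)"
    by (auto intro!: graded_dual assms)
  have T: "T1 \<in> X" "T2 \<in> X" using assms(1) by auto
  show ?thesis
    unfolding S_pair_def
    by (intro graded_diff graded_add graded_mult[OF d(1) assms(5)]
        graded_mult[OF graded_mult[OF assms(4) d(2) refl] graded_plane(1)[OF T]]
        graded_mult[OF graded_mult[OF d(2) assms(5) refl] graded_plane(2)[OF T]]) simp_all
qed

lemma graded_S_quot:
  assumes "{T1, T2, Q} \<subseteq> X" "graded r1 r X c W" "graded r1 r X c V" "graded r1 r X c A"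
    "graded r1 r X c' W'" "graded r1 r X c' V'" "graded r1 r X c' A'"
  shows "graded r1 r X (c' - c) (S_quot W V A W' V' A')"
proof -
  have d: "graded r1 r X (- c) (dual W)" "graded r1 r X (- c) (dual V)"
    "graded r1 r X (- c) (q_inv * dual A)" "graded r1 r X 0 (q_char - 1)"
    using assms(1) by (auto intro!: graded_dual graded_mult[where c = 0 and c' = "- c"] graded_q
        graded_diff graded_one assms)
  have "graded r1 r X (- c) ((q_char - 1) * (q_inv * dual A))"
    by (rule graded_mult[OF d(4,3)]) simp
  note d = d this
  have "graded r1 r X (c' - c) (dual V * A' - q_inv * dual A * V' - (q_char - 1) * (q_inv * dual A) * A')"
    by (intro graded_diff; rule graded_mult, rule d, rule assms, simp)
  then have "graded r1 r X (c' - c)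
     ((dual V * A' - q_inv * dual A * V' - (q_char - 1) * (q_inv * dual A) * A') * plane_char)"
    by (rule graded_mult[OF _ graded_plane(2)]) (use assms(1) in auto)
  moreover have "graded r1 r X (c' - c) (W' * (q_inv * dual A) * hbar_inv)"
    by (rule graded_mult[OF graded_mult graded_plane(1)], rule assms, rule d) (use assms(1) in auto)
  moreover have "graded r1 r X (c' - c) (dual W * A')"
    by (rule graded_mult, rule d, rule assms, simp)
  ultimately show ?thesis
    unfolding S_quot_def by (intro graded_diff)
qed

lemma graded_box_weight:
  assumes "{T1, T2, Q} \<subseteq> X" "Framing (fst b) \<in> X"
  shows "graded r1 r X (if fst b \<in> {r1..<r} then 1 else 0) (monomial (box_weight d b))"
proof (cases b)
  case (fields k x y)
  have k: "Framing k \<in> Framing ` {r1..<r} \<longleftrightarrow> k \<in> {r1..<r}" by auto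
  show ?thesis
    using assms unfolding fields box_weight_def prod.case monomial_add
    by (intro graded_mult[where c' = 0 and c = "if k \<in> {r1..<r} then 1 else 0"] graded_weight_pow)
      (auto simp: k)
qed

lemma graded_box_char:
  assumes "{T1, T2, Q} \<subseteq> X" "\<And>b. b \<in> set bs \<Longrightarrow> Framing (fst b) \<in> X"
    "\<And>b. b \<in> set bs \<Longrightarrow> c = (if fst b \<in> {r1..<r} then 1 else 0)"
  shows "graded r1 r X c (box_char d bs)" "graded r1 r X c (box_quot d bs)"
proof -
  have b: "graded r1 r X c (monomial (box_weight d b))" if "b \<in> set bs" for b d
    using graded_box_weight[of X b r1 r d] assms(1,2) that by (simp add: assms(3)[OF that])
  then show "graded r1 r X c (box_char d bs)"
    unfolding box_char_def by (intro graded_sum_list)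
  show "graded r1 r X c (box_quot d bs)"
    unfolding box_quot_def using assms(1)
    by (auto intro!: graded_sum_list graded_mult[OF b graded_sum] graded_power graded_q)
qed


section \<open>Evaluation\<close>

text \<open>The added factors have exponent 0. A common index set makes products for different
  weights comparable.\<close>

lemma half_val_superset:
  assumes "finite F" "Poly_Mapping.keys w \<subseteq> F"
  shows "half_val u w = (\<Prod>v\<in>F. u v powi Poly_Mapping.lookup w v)"
  unfolding half_val_def using assms by (intro prod.mono_neutral_left) (auto simp: in_keys_iff)

lemma half_val_add:
  assumes "\<And>x. x \<in> Poly_Mapping.keys v \<union> Poly_Mapping.keys w \<Longrightarrow> u x \<noteq> 0"
  shows "half_val u (v + w) = half_val u v * half_val u w"
proof -
  let ?F = "Poly_Mapping.keys v \<union> Poly_Mapping.keys w"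
  have "half_val u (v + w) = (\<Prod>x\<in>?F. u x powi Poly_Mapping.lookup (v + w) x)"
    by (rule half_val_superset) (auto dest!: subsetD[OF keys_add])
  also have "\<dots> = (\<Prod>x\<in>?F. u x powi Poly_Mapping.lookup v x * u x powi Poly_Mapping.lookup w x)"
    by (rule prod.cong) (use assms in \<open>simp_all add: lookup_add power_int_add\<close>)
  also have "\<dots> = half_val u v * half_val u w"
    by (simp add: prod.distrib half_val_superset[of ?F])
  finally show ?thesis .
qed

lemma half_val_uminus: "half_val u (- w) = inverse (half_val u w)"
  by (simp add: half_val_def power_int_minus prod_inversef[symmetric] comp_def)

lemma half_val_weight_pow: "half_val u (weight_pow v m) = u v powi m"
  by (simp add: half_val_def weight_pow_def)

lemma half_val_nonzero:
  "(\<And>x. x \<in> Poly_Mapping.keys w \<Longrightarrow> u x \<noteq> 0) \<Longrightarrow> half_val u w \<noteq> 0"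
  by (simp add: half_val_def)

section \<open>Multiplicativity of \<open>a_hat\<close>\<close>

definition a_hat_weight :: "complex \<Rightarrow> (var \<Rightarrow> complex) \<Rightarrow> weight \<Rightarrow> complex" where
  "a_hat_weight \<kappa> u w =
     (if w = 0 then \<kappa> else 1 / (half_val u w - inverse (half_val u w)))"

lemma a_hat_superset:
  assumes "finite F" "Poly_Mapping.keys T \<subseteq> F"
  shows "a_hat \<kappa> u T = (\<Prod>w\<in>F. a_hat_weight \<kappa> u w powi Poly_Mapping.lookup T w)"
  unfolding a_hat_def a_hat_weight_def[symmetric]
  using assms by (intro prod.mono_neutral_left) (auto simp: in_keys_iff)

lemma a_hat_zero: "a_hat \<kappa> u 0 = 1"
  by (simp add: a_hat_def)

lemma a_hat_monomial: "a_hat \<kappa> u (monomial w) = a_hat_weight \<kappa> u w"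
  by (simp add: a_hat_def monomial_def a_hat_weight_def)

lemma a_hat_diff:
  assumes "\<And>w. w \<in> Poly_Mapping.keys T \<union> Poly_Mapping.keys T' \<Longrightarrow> a_hat_weight \<kappa> u w \<noteq> 0"
  shows "a_hat \<kappa> u (T - T') = a_hat \<kappa> u T / a_hat \<kappa> u T'"
proof -
  let ?F = "Poly_Mapping.keys T \<union> Poly_Mapping.keys T'"
  have "a_hat \<kappa> u (T - T') = (\<Prod>w\<in>?F. a_hat_weight \<kappa> u w powi Poly_Mapping.lookup (T - T') w)"
    by (rule a_hat_superset) (auto dest!: subsetD[OF keys_diff])
  also have "\<dots> = (\<Prod>w\<in>?F. a_hat_weight \<kappa> u w powi Poly_Mapping.lookup T w
      / a_hat_weight \<kappa> u w powi Poly_Mapping.lookup T' w)"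
    by (rule prod.cong) (use assms in \<open>simp_all add: lookup_minus power_int_diff\<close>)
  also have "\<dots> = a_hat \<kappa> u T / a_hat \<kappa> u T'"
    by (simp add: prod_dividef a_hat_superset[of ?F])
  finally show ?thesis .
qed

lemma a_hat_add:
  assumes "\<And>w. w \<in> Poly_Mapping.keys T \<union> Poly_Mapping.keys T' \<Longrightarrow> a_hat_weight \<kappa> u w \<noteq> 0"
  shows "a_hat \<kappa> u (T + T') = a_hat \<kappa> u T * a_hat \<kappa> u T'"
  using a_hat_diff[of T "- T'" \<kappa> u] a_hat_diff[of 0 "T'" \<kappa> u] assms
  by (simp add: a_hat_zero)

lemma a_hat_nonzero:
  "(\<And>w. w \<in> Poly_Mapping.keys T \<Longrightarrow> a_hat_weight \<kappa> u w \<noteq> 0) \<Longrightarrow> a_hat \<kappa> u T \<noteq> 0"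
  by (simp add: a_hat_def a_hat_weight_def[symmetric])

lemma a_hat_cong:
  "(\<And>w. w \<in> Poly_Mapping.keys T \<Longrightarrow> a_hat_weight \<kappa> u w = a_hat_weight \<kappa> u' w) \<Longrightarrow>
    a_hat \<kappa> u T = a_hat \<kappa> u' T"
  by (simp add: a_hat_def a_hat_weight_def[symmetric])

text \<open>Since division by zero yields 0, the factor of a nontrivial weight could vanish only
  where its denominator does, and that would force the half value to square to 1.\<close>

lemma a_hat_weight_nonzero:
  assumes "half_val u w \<noteq> 0" "half_val u w \<noteq> 1" "half_val u w \<noteq> -1" "\<kappa> \<noteq> 0"
  shows "a_hat_weight \<kappa> u w \<noteq> 0"
proof -
  have "half_val u w * half_val u w \<noteq> 1"
    using assms(2,3) by (simp add: square_eq_1_iff)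
  then show ?thesis
    using assms(1,4) by (auto simp: a_hat_weight_def field_simps)
qed

section \<open>Generic points and their scaling by the splitting subgroup\<close>

definition vars :: "nat \<Rightarrow> var set" where
  "vars r = {T1, T2, Q} \<union> Framing ` {..<r}"

lemma finite_vars: "finite (vars r)"
  by (simp add: vars_def)

lemma generic_nonzero: "generic r u \<Longrightarrow> v \<in> vars r \<Longrightarrow> u v \<noteq> 0"
  unfolding generic_def vars_def Let_def by blast

text \<open>The value -1 is excluded by genericity at \<open>w + w\<close>, which is nonzero because
  the weight lattice is torsion free.\<close>

lemma generic_half_val:
  assumes "generic r u" "Poly_Mapping.keys w \<subseteq> vars r"
  shows "half_val u w \<noteq> 0" "w \<noteq> 0 \<Longrightarrow> half_val u w \<noteq> 1" "w \<noteq> 0 \<Longrightarrow> half_val u w \<noteq> -1"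
proof -
  have nz: "u x \<noteq> 0" if "x \<in> Poly_Mapping.keys w" for x
    using generic_nonzero assms that by blast
  then show "half_val u w \<noteq> 0" by (rule half_val_nonzero)
  have g: "half_val u v \<noteq> 1" if "Poly_Mapping.keys v \<subseteq> vars r" "v \<noteq> 0" for v
    using assms(1) that unfolding generic_def vars_def Let_def by blast
  then show "half_val u w \<noteq> 1" if "w \<noteq> 0" using assms(2) that by blast
  show "half_val u w \<noteq> -1" if "w \<noteq> 0"
  proof
    assume "half_val u w = -1"
    moreover have "half_val u (w + w) = half_val u w * half_val u w"
      using nz by (intro half_val_add) blast
    ultimately have "half_val u (w + w) = 1" by simp
    moreover have "w + w \<noteq> 0"
    proof
      assume *: "w + w = 0"
      have "Poly_Mapping.lookup w x = 0" for x
        using arg_cong[OF *, of "\<lambda>f. Poly_Mapping.lookup f x"] by (simp add: lookup_add)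
      then have "w = 0" by (intro poly_mapping_eqI) simp
      with that show False ..
    qed
    ultimately show False
      using g[of "w + w"] assms(2) keys_add[of w w] by blast
  qed
qed

lemma generic_a_hat_weight:
  assumes "generic r u" "Poly_Mapping.keys w \<subseteq> vars r" "\<kappa> \<noteq> 0"
  shows "a_hat_weight \<kappa> u w \<noteq> 0"
proof (cases "w = 0")
  case True
  with assms(3) show ?thesis by (simp add: a_hat_weight_def)
next
  case False
  with assms generic_half_val[OF assms(1,2)] show ?thesis
    by (intro a_hat_weight_nonzero) auto
qed

lemma prod_power_int: "(s :: complex) \<noteq> 0 \<Longrightarrow> (\<Prod>i\<in>I. s powi f i) = s powi (\<Sum>i\<in>I. f i)"
  by (induction I rule: infinite_finite_induct) (simp_all add: power_int_add)

text \<open>Each scaled framing variable contributes \<open>s\<close> to its exponent in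
  \<open>w\<close>, and these exponents add up to the degree of \<open>w\<close>.\<close>

lemma half_val_split_framing:
  assumes "s \<noteq> 0" "Poly_Mapping.keys w \<subseteq> vars r"
  shows "half_val (split_framing r1 s u) w = s powi C_degree r1 r w * half_val u w"
proof -
  let ?l = "Poly_Mapping.lookup w"
  have sub: "Framing ` {r1..<r} \<subseteq> vars r" by (auto simp: vars_def)
  have f: "split_framing r1 s u v powi ?l v
      = (if v \<in> Framing ` {r1..<r} then s powi ?l v else 1) * u v powi ?l v" if "v \<in> vars r" for v
    using that by (cases v) (auto simp: split_framing_def vars_def power_int_mult_distrib)
  have "half_val (split_framing r1 s u) w
      = (\<Prod>v\<in>vars r. if v \<in> Framing ` {r1..<r} then s powi ?l v else 1) * half_val u w"
    by (simp add: half_val_superset[OF finite_vars assms(2)] f prod.distrib cong: prod.cong)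
  also have "(\<Prod>v\<in>vars r. if v \<in> Framing ` {r1..<r} then s powi ?l v else 1)
      = (\<Prod>v\<in>Framing ` {r1..<r}. s powi ?l v)"
    using prod.inter_restrict[OF finite_vars, of "\<lambda>v. s powi ?l v" r "Framing ` {r1..<r}"] sub
    by (simp add: Int_absorb1)
  also have "\<dots> = s powi C_degree r1 r w"
    by (subst prod.reindex) (auto simp: inj_on_def C_degree_def prod_power_int[OF assms(1)])
  finally show ?thesis .
qed

lemma a_hat_split_framing_graded_0:
  assumes "graded r1 r (vars r) 0 T" "s \<noteq> 0"
  shows "a_hat \<kappa> (split_framing r1 s u) T = a_hat \<kappa> u T"
  using assms by (intro a_hat_cong) (auto simp: graded_def a_hat_weight_def half_val_split_framing)

text \<open>Genericity is assumed at \<open>u\<close> only, not at the scaled points. Degree 0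
  weights do not see \<open>s\<close>, and each of the finitely many others excludes finitely many
  values of \<open>s\<close>.\<close>

lemma eventually_a_hat_weight_nonzero:
  assumes "generic r u" "\<kappa> \<noteq> 0" "graded r1 r (vars r) c T" "c \<in> {-1, 0, 1}"
  shows "\<forall>\<^sub>F s in at 0. \<forall>w\<in>Poly_Mapping.keys T. a_hat_weight \<kappa> (split_framing r1 s u) w \<noteq> 0"
proof (intro eventually_ball_finite ballI finite_keys)
  fix w assume w: "w \<in> Poly_Mapping.keys T"
  then have k: "Poly_Mapping.keys w \<subseteq> vars r" and c: "C_degree r1 r w = c"
    using assms(3) by (auto simp: graded_def)
  let ?x = "half_val u w"
  have x: "?x \<noteq> 0" by (rule generic_half_val[OF assms(1) k])
  \<comment> \<open>The nonzero exceptions solve \<open>s * ?x = 1\<close> or \<open>-1\<close> in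
    degree 1, and \<open>?x / s = 1\<close> or \<open>-1\<close> in degree -1.\<close>
  have ev: "\<forall>\<^sub>F s in at (0::complex). s \<noteq> 0 \<and> s \<noteq> ?x \<and> s \<noteq> - ?x \<and> s \<noteq> 1 / ?x \<and> s \<noteq> - 1 / ?x"
    by (intro eventually_conj eventually_neq_at_within)
  show "\<forall>\<^sub>F s in at 0. a_hat_weight \<kappa> (split_framing r1 s u) w \<noteq> 0"
    using ev
  proof eventually_elim
    case (elim s)
    have h: "half_val (split_framing r1 s u) w = s powi c * ?x"
      using elim half_val_split_framing[OF _ k, of s r1 u] c by simp
    consider "c = 0" | "c = 1" | "c = -1" using assms(4) by auto
    then show ?case
    proof cases
      case 1
      then show ?thesis
        using h generic_a_hat_weight[OF assms(1) k assms(2)]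
        by (auto simp: a_hat_weight_def split: if_splits)
    next
      case 2
      show ?thesis
        by (rule a_hat_weight_nonzero) (use 2 h x elim assms(2) in \<open>auto simp: field_simps\<close>)
    next
      case 3
      then have h: "?x = s * half_val (split_framing r1 s u) w"
        using h elim by (simp add: field_simps power_int_minus)
      show ?thesis
        by (rule a_hat_weight_nonzero) (use h x elim assms(2) in auto)
    qed
  qed
qed


text \<open>
  For a weight \<open>w\<close> of degree 1 the factors of \<open>w\<close> and of \<open>- w - p\<close> tend to 0 like \<open>s\<close>,
  with quotient tending to \<open>- p\<^sup>-\<^sup>1\<^sup>/\<^sup>2\<close>.
\<close>

lemma tendsto_a_hat_split_framing:
  assumes gen: "generic r u" and \<kappa>: "\<kappa> \<noteq> 0" and T: "graded r1 r (vars r) 1 T"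
    and p: "Poly_Mapping.keys p \<subseteq> vars r" "C_degree r1 r p = 0"
  shows "((\<lambda>s. a_hat \<kappa> (split_framing r1 s u) (T - dual T * monomial (- p)))
    \<longlongrightarrow> (- inverse (half_val u p)) powi char_rank T) (at 0)"
proof -
  let ?S = "{w. Poly_Mapping.keys w \<subseteq> vars r \<and> C_degree r1 r w = 1}"
  let ?u = "\<lambda>s. split_framing r1 s u"
  let ?h = "\<lambda>T. T - dual T * monomial (- p)"
  define c where "c = - inverse (half_val u p)"
  have P: "half_val u p \<noteq> 0" by (rule generic_half_val[OF gen p(1)])
  then have c0: "c \<noteq> 0" by (simp add: c_def)
  have gr: "graded r1 r (vars r) 1 T" "graded r1 r (vars r) (-1) (dual T * monomial (- p))"
    if "Poly_Mapping.keys T \<subseteq> ?S" for T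
  proof -
    show T: "graded r1 r (vars r) 1 T" using that by (auto simp: graded_def)
    show "graded r1 r (vars r) (-1) (dual T * monomial (- p))"
      using p by (intro graded_mult[OF graded_dual[OF T refl] graded_monomial[OF _ refl]])
        (simp_all add: C_degree_uminus)
  qed
  have ev: "\<forall>\<^sub>F s in at 0. \<forall>w\<in>Poly_Mapping.keys T \<union> Poly_Mapping.keys (dual T * monomial (- p)).
      a_hat_weight \<kappa> (?u s) w \<noteq> 0" if "Poly_Mapping.keys T \<subseteq> ?S" for T
    using eventually_conj[OF eventually_a_hat_weight_nonzero[OF gen \<kappa> gr(1)[OF that]]
        eventually_a_hat_weight_nonzero[OF gen \<kappa> gr(2)[OF that]]]
    by (simp add: ball_Un)
  \<comment> \<open>Both sides turn differences of characters into quotients, which reduces the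
    claim to a single weight.\<close>
  have "Poly_Mapping.keys T \<subseteq> ?S" using T by (auto simp: graded_def)
  then show ?thesis
    unfolding c_def[symmetric]
  proof (induction T rule: char_induct_keys)
    case zero
    show ?case by (simp add: dual_zero a_hat_zero char_rank_zero)
  next
    case (monomial w)
    then have w: "Poly_Mapping.keys w \<subseteq> vars r" "C_degree r1 r w = 1" by auto
    let ?x = "half_val u w" and ?P = "half_val u p"
    have x: "?x \<noteq> 0" by (rule generic_half_val[OF gen w(1)])
    have w': "Poly_Mapping.keys (- w - p) \<subseteq> vars r" "C_degree r1 r (- w - p) = -1"
      using w p keys_diff[of "- w" p] C_degree_add[of r1 r "- w" "- p"]
      by (auto simp: C_degree_uminus)
    have hw': "half_val u (- w - p) = inverse ?x * inverse ?P"
    proof -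
      have "half_val u (- w + - p) = half_val u (- w) * half_val u (- p)"
        using w p generic_nonzero[OF gen] by (intro half_val_add) auto
      then show ?thesis by (simp add: half_val_uminus)
    qed
    have nz: "w \<noteq> 0" "- w - p \<noteq> 0"
      using w(2) w'(2) by (auto simp: C_degree_zero)
    \<comment> \<open>This is the quotient of the two factors with the common \<open>s * ?x\<close>
      cancelled. It is continuous at 0, where its value is \<open>- 1 / ?P\<close>.\<close>
    have "((\<lambda>s. (1 - s\<^sup>2 * ?x\<^sup>2 * ?P\<^sup>2) / (?P * (s\<^sup>2 * ?x\<^sup>2 - 1))) \<longlongrightarrow>
        (1 - 0\<^sup>2 * ?x\<^sup>2 * ?P\<^sup>2) / (?P * (0\<^sup>2 * ?x\<^sup>2 - 1))) (at 0)"
      using P by (intro tendsto_intros) auto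
    then have lim: "((\<lambda>s. (1 - s\<^sup>2 * ?x\<^sup>2 * ?P\<^sup>2) / (?P * (s\<^sup>2 * ?x\<^sup>2 - 1))) \<longlongrightarrow> c) (at 0)"
      by (simp add: c_def field_simps)
    have m: "Poly_Mapping.keys (monomial w) \<subseteq> ?S" using w by (simp add: monomial_def)
    have "\<forall>\<^sub>F s in at 0. (1 - s\<^sup>2 * ?x\<^sup>2 * ?P\<^sup>2) / (?P * (s\<^sup>2 * ?x\<^sup>2 - 1))
        = a_hat \<kappa> (?u s) (?h (monomial w))"
      using ev[OF m] eventually_neq_at_within[of 0]
    proof eventually_elim
      case (elim s)
      have hw: "half_val (?u s) w = s * ?x" "half_val (?u s) (- w - p) = inverse s * (inverse ?x * inverse ?P)"
        using half_val_split_framing[OF elim(2), of w r r1 u]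
          half_val_split_framing[OF elim(2), of "- w - p" r r1 u] w w' hw'
        by (simp_all add: power_int_minus)
      \<comment> \<open>The second form serves \<open>- w - p\<close>, whose half value is the
        inverse of \<open>s * ?x * ?P\<close>.\<close>
      have y: "1 / (y - inverse y) = y / (y\<^sup>2 - 1)" "1 / (inverse y - y) = y / (1 - y\<^sup>2)"
        if "y \<noteq> 0" for y :: complex
      proof -
        have "y - inverse y = (y\<^sup>2 - 1) / y" "inverse y - y = (1 - y\<^sup>2) / y"
          using that by (simp_all add: field_simps power2_eq_square)
        then show "1 / (y - inverse y) = y / (y\<^sup>2 - 1)" "1 / (inverse y - y) = y / (1 - y\<^sup>2)"
          by simp_all
      qed
      have "a_hat \<kappa> (?u s) (?h (monomial w))
          = a_hat_weight \<kappa> (?u s) w / a_hat_weight \<kappa> (?u s) (- w - p)"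
        using elim(1) by (subst a_hat_diff)
          (auto simp: dual_monomial monomial_add[symmetric] a_hat_monomial)
      also have "a_hat_weight \<kappa> (?u s) w = (s * ?x) / ((s * ?x)\<^sup>2 - 1)"
        using y(1)[of "s * ?x"] elim x nz(1) by (simp add: a_hat_weight_def hw)
      also have "a_hat_weight \<kappa> (?u s) (- w - p) = (s * ?x * ?P) / (1 - (s * ?x * ?P)\<^sup>2)"
        using y(2)[of "s * ?x * ?P"] elim x P nz(2) by (simp add: a_hat_weight_def hw mult.assoc)
      also have "(s * ?x) / ((s * ?x)\<^sup>2 - 1) / ((s * ?x * ?P) / (1 - (s * ?x * ?P)\<^sup>2))
          = (1 - s\<^sup>2 * ?x\<^sup>2 * ?P\<^sup>2) / (?P * (s\<^sup>2 * ?x\<^sup>2 - 1))"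
        using elim x P by (simp add: power_mult_distrib)
      finally show ?case by simp
    qed
    from Lim_transform_eventually[OF lim this] show ?case
      by (simp add: char_rank_monomial)
  next
    case (diff T T')
    have h: "?h (T - T') = ?h T - ?h T'"
      by (simp add: dual_diff left_diff_distrib)
    have "((\<lambda>s. a_hat \<kappa> (?u s) (?h T) / a_hat \<kappa> (?u s) (?h T')) \<longlongrightarrow>
        c powi char_rank T / c powi char_rank T') (at 0)"
      using diff c0 by (intro tendsto_divide) auto
    moreover have "\<forall>\<^sub>F s in at 0. a_hat \<kappa> (?u s) (?h T) / a_hat \<kappa> (?u s) (?h T')
        = a_hat \<kappa> (?u s) (?h (T - T'))"
      using ev[OF diff(1)] ev[OF diff(2)]
    proof eventually_elim
      case (elim s)
      show ?case
        unfolding h using elim keys_diff[of T "dual T * monomial (- p)"]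
          keys_diff[of T' "dual T' * monomial (- p)"]
        by (intro a_hat_diff[symmetric]) blast
    qed
    ultimately show ?case
      using c0 by (auto simp: char_rank_diff power_int_diff intro: Lim_transform_eventually)
  qed
qed


section \<open>Renumbering the framings\<close>

definition shift_var :: "nat \<Rightarrow> var \<Rightarrow> var" where
  "shift_var r1 v = (case v of Framing k \<Rightarrow> Framing (r1 + k) | _ \<Rightarrow> v)"

lemma inj_shift_var: "inj (shift_var r1)"
  by (rule injI) (auto simp: shift_var_def split: var.splits)

lemma shift_framing_eq: "shift_framing r1 u v = u (shift_var r1 v)"
  by (simp add: shift_framing_def shift_var_def split: var.split)

text \<open>
  Weights are pulled back along the renumbering; this inverts it on the weights that involve only
  the framings from number \<open>r1\<close> on.
\<close>

definition unshift_weight :: "nat \<Rightarrow> weight \<Rightarrow> weight" where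
  "unshift_weight r1 w = Poly_Mapping.map_key (shift_var r1) w"

text \<open>\<open>unshift_weight\<close> forgets the framings below \<open>r1\<close> and need not
  be injective, so it is extended additively. This gives a ring homomorphism on all
  characters.\<close>

definition unshift_char :: "nat \<Rightarrow> character \<Rightarrow> character" where
  "unshift_char r1 = frag_extend (\<lambda>w. monomial (unshift_weight r1 w))"

lemma lookup_unshift_weight:
  "Poly_Mapping.lookup (unshift_weight r1 w) v = Poly_Mapping.lookup w (shift_var r1 v)"
  by (simp add: unshift_weight_def map_key.rep_eq[OF inj_shift_var])

lemma unshift_weight_add: "unshift_weight r1 (v + w) = unshift_weight r1 v + unshift_weight r1 w"
  by (intro poly_mapping_eqI) (simp add: lookup_unshift_weight lookup_add)

lemma unshift_weight_uminus: "unshift_weight r1 (- w) = - unshift_weight r1 w"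
  by (intro poly_mapping_eqI) (simp add: lookup_unshift_weight)

lemma unshift_weight_pow: "unshift_weight r1 (weight_pow (shift_var r1 v) m) = weight_pow v m"
  by (intro poly_mapping_eqI)
    (simp add: lookup_unshift_weight weight_pow_def lookup_single inj_eq[OF inj_shift_var])

lemma keys_unshift_weight:
  "Poly_Mapping.keys (unshift_weight r1 w) = shift_var r1 -` Poly_Mapping.keys w"
  by (auto simp: in_keys_iff lookup_unshift_weight)

lemma unshift_monomial: "unshift_char r1 (monomial w) = monomial (unshift_weight r1 w)"
  by (simp add: unshift_char_def monomial_def)

lemma unshift_zero: "unshift_char r1 0 = 0"
  by (simp add: unshift_char_def)

lemma unshift_one: "unshift_char r1 1 = 1"
proof -
  have "unshift_weight r1 0 = 0"
    by (intro poly_mapping_eqI) (simp add: lookup_unshift_weight)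
  then show ?thesis using unshift_monomial[of r1 0] by (simp add: monomial_zero)
qed

lemma unshift_add: "unshift_char r1 (T + T') = unshift_char r1 T + unshift_char r1 T'"
  by (simp add: unshift_char_def frag_extend_add)

lemma unshift_diff: "unshift_char r1 (T - T') = unshift_char r1 T - unshift_char r1 T'"
  by (simp add: unshift_char_def frag_extend_diff)

lemma unshift_mult: "unshift_char r1 (T * T') = unshift_char r1 T * unshift_char r1 T'"
proof (induction T rule: char_induct)
  case (monomial w)
  show ?case
  proof (induction T' rule: char_induct)
    case (monomial w')
    show ?case by (simp add: unshift_monomial monomial_add[symmetric] unshift_weight_add)
  qed (simp_all add: unshift_zero unshift_diff right_diff_distrib)
qed (simp_all add: unshift_zero unshift_diff left_diff_distrib)

lemma unshift_dual: "unshift_char r1 (dual T) = dual (unshift_char r1 T)"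
  by (induction T rule: char_induct)
    (simp_all add: dual_zero unshift_zero dual_diff unshift_diff dual_monomial unshift_monomial
      unshift_weight_uminus)

lemma unshift_sum: "unshift_char r1 (\<Sum>i\<in>I. f i) = (\<Sum>i\<in>I. unshift_char r1 (f i))"
  by (induction I rule: infinite_finite_induct) (simp_all add: unshift_add unshift_zero)

lemma unshift_sum_list: "unshift_char r1 (\<Sum>i\<leftarrow>xs. f i) = (\<Sum>i\<leftarrow>xs. unshift_char r1 (f i))"
  by (induction xs) (simp_all add: unshift_add unshift_zero)

lemma unshift_power: "unshift_char r1 (T ^ n) = unshift_char r1 T ^ n"
  by (induction n) (simp_all add: unshift_one unshift_mult)

lemma unshift_weight_pow_plane:
  "unshift_weight r1 (weight_pow T1 m) = weight_pow T1 m"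
  "unshift_weight r1 (weight_pow T2 m) = weight_pow T2 m"
  "unshift_weight r1 (weight_pow Q m) = weight_pow Q m"
  "unshift_weight r1 (weight_pow (Framing (r1 + k)) m) = weight_pow (Framing k) m"
  using unshift_weight_pow[of r1 T1 m] unshift_weight_pow[of r1 T2 m] unshift_weight_pow[of r1 Q m]
    unshift_weight_pow[of r1 "Framing k" m]
  by (simp_all add: shift_var_def)

lemma unshift_constants:
  "unshift_char r1 q_char = q_char" "unshift_char r1 q_inv = q_inv"
  "unshift_char r1 hbar_inv = hbar_inv" "unshift_char r1 plane_char = plane_char"
  by (simp_all add: q_char_def q_inv_def hbar_inv_def plane_char_def unshift_mult unshift_diff
      unshift_one unshift_monomial unshift_weight_pow_plane)

lemma unshift_S_pair: "unshift_char r1 (S_pair W V W' V') =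
    S_pair (unshift_char r1 W) (unshift_char r1 V) (unshift_char r1 W') (unshift_char r1 V')"
  by (simp add: S_pair_def unshift_add unshift_diff unshift_mult unshift_dual unshift_constants)

lemma unshift_S_quot: "unshift_char r1 (S_quot W V A W' V' A') =
    S_quot (unshift_char r1 W) (unshift_char r1 V) (unshift_char r1 A)
      (unshift_char r1 W') (unshift_char r1 V') (unshift_char r1 A')"
  by (simp add: S_quot_def unshift_add unshift_diff unshift_mult unshift_dual unshift_constants unshift_one)

section \<open>Renumbering of boxes and invariance of the evaluation\<close>

definition shift_box :: "nat \<Rightarrow> box \<Rightarrow> box" where
  "shift_box r1 = (\<lambda>(k, x, y). (r1 + k, x, y))"

lemma unshift_box_weight:
  "unshift_weight r1 (box_weight d (shift_box r1 b)) = box_weight (\<lambda>b. d (shift_box r1 b)) b"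
  by (cases b) (simp add: box_weight_def shift_box_def unshift_weight_add unshift_weight_pow_plane)

lemma unshift_box_char:
  "unshift_char r1 (box_char d (map (shift_box r1) bs)) = box_char (\<lambda>b. d (shift_box r1 b)) bs"
  "unshift_char r1 (box_quot d (map (shift_box r1) bs)) = box_quot (\<lambda>b. d (shift_box r1 b)) bs"
  by (simp_all add: box_char_def box_quot_def unshift_sum_list comp_def unshift_monomial
      unshift_box_weight unshift_mult unshift_sum unshift_power unshift_constants)

lemma half_val_unshift:
  assumes "Poly_Mapping.keys w \<subseteq> range (shift_var r1)"
  shows "half_val (shift_framing r1 u) (unshift_weight r1 w) = half_val u w"
proof -
  let ?K = "shift_var r1 -` Poly_Mapping.keys w"
  have K: "shift_var r1 ` ?K = Poly_Mapping.keys w" using assms by blast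
  have "half_val u w = (\<Prod>v\<in>shift_var r1 ` ?K. u v powi Poly_Mapping.lookup w v)"
    unfolding K half_val_def ..
  also have "\<dots> = (\<Prod>v\<in>?K. u (shift_var r1 v) powi Poly_Mapping.lookup w (shift_var r1 v))"
    by (subst prod.reindex) (use inj_shift_var in \<open>auto simp: inj_on_def inj_def\<close>)
  finally show ?thesis
    by (simp add: half_val_def keys_unshift_weight lookup_unshift_weight shift_framing_eq)
qed

lemma a_hat_weight_unshift:
  assumes "Poly_Mapping.keys w \<subseteq> range (shift_var r1)"
  shows "a_hat_weight \<kappa> (shift_framing r1 u) (unshift_weight r1 w) = a_hat_weight \<kappa> u w"
proof -
  have "unshift_weight r1 w = 0 \<longleftrightarrow> w = 0"
    using assms unfolding keys_eq_empty[symmetric] keys_unshift_weight by blast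
  then show ?thesis
    by (simp add: a_hat_weight_def half_val_unshift[OF assms])
qed

text \<open>Weights supported on the renumbered variables lose nothing, so each keeps its factor.
  Nonvanishing carries over to the renumbered side, and induction over differences applies on both
  sides.\<close>

lemma a_hat_unshift:
  assumes "\<And>w. w \<in> Poly_Mapping.keys T \<Longrightarrow> Poly_Mapping.keys w \<subseteq> range (shift_var r1)"
    and "\<And>w. w \<in> Poly_Mapping.keys T \<Longrightarrow> a_hat_weight \<kappa> u w \<noteq> 0"
  shows "a_hat \<kappa> (shift_framing r1 u) (unshift_char r1 T) = a_hat \<kappa> u T"
proof -
  let ?S = "{w. Poly_Mapping.keys w \<subseteq> range (shift_var r1) \<and> a_hat_weight \<kappa> u w \<noteq> 0}"
  have nz: "a_hat_weight \<kappa> (shift_framing r1 u) w \<noteq> 0"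
    if T: "Poly_Mapping.keys T \<subseteq> ?S" and w: "w \<in> Poly_Mapping.keys (unshift_char r1 T)" for T w
  proof -
    obtain v where "v \<in> Poly_Mapping.keys T" "w = unshift_weight r1 v"
      using w keys_frag_extend[of "\<lambda>w. monomial (unshift_weight r1 w)" T]
      by (auto simp: unshift_char_def monomial_def)
    then show ?thesis using T by (auto simp: a_hat_weight_unshift)
  qed
  have "Poly_Mapping.keys T \<subseteq> ?S" using assms by blast
  then show ?thesis
  proof (induction T rule: char_induct_keys)
    case (diff T T')
    have "a_hat \<kappa> (shift_framing r1 u) (unshift_char r1 (T - T'))
        = a_hat \<kappa> (shift_framing r1 u) (unshift_char r1 T)
          / a_hat \<kappa> (shift_framing r1 u) (unshift_char r1 T')"
      unfolding unshift_diff using nz[OF diff(1)] nz[OF diff(2)] by (intro a_hat_diff) blast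
    also have "\<dots> = a_hat \<kappa> u (T - T')"
      unfolding diff(3,4) using diff(1,2) by (intro a_hat_diff[symmetric]) blast
    finally show ?case .
  qed (simp_all add: unshift_zero a_hat_zero unshift_monomial a_hat_monomial a_hat_weight_unshift)
qed


section \<open>Splitting a fixed point\<close>

lemma sum_lessThan_add:
  "(\<Sum>k<m + n. f k) = (\<Sum>k<m. f k) + (\<Sum>k<n. f (m + k))" for f :: "nat \<Rightarrow> 'a::comm_monoid_add"
  by (induction n) (simp_all add: add.assoc)

text \<open>An equality of lists is needed because \<open>descendent_value\<close> assigns variables
  to boxes by position; the boxes of the first factor take the leading variables.\<close>

lemma boxes_append: "boxes (\<mu> @ \<nu>) = boxes \<mu> @ map (shift_box (length \<mu>)) (boxes \<nu>)"
proof -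
  define f :: "nat list list \<Rightarrow> nat \<Rightarrow> box list"
    where "f \<mu> k = concat (map (\<lambda>x. map (\<lambda>y. (k, x, y)) [0..<\<mu> ! k ! x]) [0..<length (\<mu> ! k)])" for \<mu> k
  have boxes: "boxes \<mu> = concat (map (f \<mu>) [0..<length \<mu>])" for \<mu>
    unfolding boxes_def f_def ..
  have "[length \<mu>..<length \<mu> + length \<nu>] = map (\<lambda>k. length \<mu> + k) [0..<length \<nu>]"
    by (rule nth_equalityI) auto
  then have u: "[0..<length (\<mu> @ \<nu>)] = [0..<length \<mu>] @ map (\<lambda>k. length \<mu> + k) [0..<length \<nu>]"
    using upt_add_eq_append[of 0 "length \<mu>" "length \<nu>"] by simp
  have 1: "map (f (\<mu> @ \<nu>)) [0..<length \<mu>] = map (f \<mu>) [0..<length \<mu>]"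
    by (rule map_cong) (simp_all add: f_def nth_append)
  have 2: "f (\<mu> @ \<nu>) (length \<mu> + k) = map (shift_box (length \<mu>)) (f \<nu> k)" for k
    by (simp add: f_def map_concat comp_def shift_box_def)
  show ?thesis
    unfolding boxes u map_append 1 concat_append map_map comp_def 2 map_concat ..
qed

lemma set_boxes: "(k, x, y) \<in> set (boxes \<mu>) \<longleftrightarrow> k < length \<mu> \<and> x < length (\<mu> ! k) \<and> y < \<mu> ! k ! x"
  by (auto simp: boxes_def image_iff)

lemma fst_less_length: "b \<in> set (boxes \<mu>) \<Longrightarrow> fst b < length \<mu>"
  by (cases b) (simp add: set_boxes)

lemma boxes_split:
  "r1 \<le> length \<mu> \<Longrightarrow> boxes \<mu> = boxes (take r1 \<mu>) @ map (shift_box r1) (boxes (drop r1 \<mu>))"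
  using boxes_append[of "take r1 \<mu>" "drop r1 \<mu>"] by simp

lemma box_char_append: "box_char d (bs @ bs') = box_char d bs + box_char d bs'"
  by (simp add: box_char_def)

lemma box_quot_append: "box_quot d (bs @ bs') = box_quot d bs + box_quot d bs'"
  by (simp add: box_quot_def)

lemma box_quot_cong: "(\<And>b. b \<in> set bs \<Longrightarrow> d b = d' b) \<Longrightarrow> box_quot d bs = box_quot d' bs"
  unfolding box_quot_def by (intro arg_cong[of _ _ sum_list] map_cong) auto

text \<open>The weights of \<open>G\<close> and \<open>N\<close> have different degrees, so nothing
  cancels between them and selecting the nonzero degrees recovers \<open>N\<close> with its
  multiplicities.\<close>

lemma normal_char_eqI:
  assumes "tangent_char \<mu> = G + N"
    and "\<And>w. w \<in> Poly_Mapping.keys G \<Longrightarrow> C_degree r1 (length \<mu>) w = 0"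
    and "\<And>w. w \<in> Poly_Mapping.keys N \<Longrightarrow> C_degree r1 (length \<mu>) w \<noteq> 0"
  shows "normal_char r1 \<mu> = N"
proof (rule poly_mapping_eqI)
  fix v
  let ?t = "tangent_char \<mu>"
  let ?K = "{w \<in> Poly_Mapping.keys ?t. C_degree r1 (length \<mu>) w \<noteq> 0}"
  have "Poly_Mapping.lookup (normal_char r1 \<mu>) v
      = (\<Sum>w\<in>?K. if w = v then Poly_Mapping.lookup ?t w else 0)"
    by (simp add: normal_char_def lookup_sum lookup_single when_def)
  also have "\<dots> = (if v \<in> ?K then Poly_Mapping.lookup ?t v else 0)"
    by (subst sum.delta) auto
  also have "\<dots> = (if C_degree r1 (length \<mu>) v \<noteq> 0 then Poly_Mapping.lookup ?t v else 0)"
    by (auto simp: in_keys_iff)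
  also have "\<dots> = Poly_Mapping.lookup N v"
    using assms(2,3)[of v] by (auto simp: assms(1) lookup_add in_keys_iff)
  finally show "Poly_Mapping.lookup (normal_char r1 \<mu>) v = Poly_Mapping.lookup N v" .
qed

text \<open>The prefactor cancels the normal part exactly and the degree 0 part is constant in
  \<open>s\<close>, so only the mixed quotients have a limit to compute.\<close>

lemma tendsto_a_hat_T_vir:
  assumes gen: "generic r u" and \<kappa>: "\<kappa> \<noteq> 0" and r: "r = r1 + r2" "length \<mu> = r"
    and d1: "\<And>b. b \<in> set (boxes (take r1 \<mu>)) \<Longrightarrow> d1 b = d b"
    and d2: "d2 = (\<lambda>b. d (shift_box r1 b))"
  shows "((\<lambda>s. inverse (a_hat \<kappa> (split_framing r1 s u) (normal_char r1 \<mu>)) *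
        a_hat \<kappa> (split_framing r1 s u) (T_vir \<mu> d)) \<longlongrightarrow>
      a_hat \<kappa> u (T_vir (take r1 \<mu>) d1) * a_hat \<kappa> (shift_framing r1 u) (T_vir (drop r1 \<mu>) d2) *
      (- inverse (u Q * (u T1 * u T2))) powi
        (int (r1 * total_degree (drop r1 \<mu>) d2) - int (r2 * total_degree (take r1 \<mu>) d1))) (at 0)"
proof -
  define bs1 where "bs1 = boxes (take r1 \<mu>)"
  define bs2 where "bs2 = map (shift_box r1) (boxes (drop r1 \<mu>))"
  define W1 where "W1 = (\<Sum>k<r1. monomial (weight_pow (Framing k) 1))"
  define W2 where "W2 = (\<Sum>k<r2. monomial (weight_pow (Framing (r1 + k)) 1))"
  define V1 where "V1 = box_char (\<lambda>_. 0) bs1"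
  define V2 where "V2 = box_char (\<lambda>_. 0) bs2"
  define A1 where "A1 = box_quot d bs1"
  define A2 where "A2 = box_quot d bs2"
  \<comment> \<open>\<open>G1\<close> and \<open>G2\<close> belong to the two factors,
    \<open>N1 + N2\<close> is the normal space, and \<open>M1\<close>, \<open>M2\<close> are the
    mixed quotients of degree 1 and -1.\<close>
  define G1 where "G1 = S_pair W1 V1 W1 V1 + S_quot W1 V1 A1 W1 V1 A1"
  define G2 where "G2 = S_pair W2 V2 W2 V2 + S_quot W2 V2 A2 W2 V2 A2"
  define N1 where "N1 = S_pair W1 V1 W2 V2"
  define N2 where "N2 = S_pair W2 V2 W1 V1"
  define M1 where "M1 = S_quot W1 V1 A1 W2 V2 A2"
  define M2 where "M2 = S_quot W2 V2 A2 W1 V1 A1"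
  \<comment> \<open>The weight of \<open>q * hbar\<close>, by which the duality between
    \<open>M1\<close> and \<open>M2\<close> is twisted.\<close>
  define p where "p = weight_pow Q 1 + weight_pow T1 1 + weight_pow T2 1"
  define X2 where "X2 = {T1, T2, Q} \<union> Framing ` {r1..<r}"
  let ?u = "\<lambda>s. split_framing r1 s u"
  have boxes: "boxes \<mu> = bs1 @ bs2"
    using boxes_split[of r1 \<mu>] r by (simp add: bs1_def bs2_def)
  have W: "W_char \<mu> = W1 + W2"
    by (simp add: W_char_def W1_def W2_def r sum_lessThan_add)
  have V: "V_char \<mu> (\<lambda>_. 0) = V1 + V2"
    by (simp add: V_char_eq boxes box_char_append V1_def V2_def)
  have A: "box_quot d (boxes \<mu>) = A1 + A2"
    by (simp add: boxes box_quot_append A1_def A2_def)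
  have T: "T_vir \<mu> d = G1 + G2 + (N1 + N2) + (M1 + M2)"
    unfolding T_vir_eq_S_quot W V A S_pair_add S_quot_add
    by (simp add: G1_def G2_def N1_def N2_def M1_def M2_def)
  have T1: "T_vir (take r1 \<mu>) d1 = G1"
  proof -
    have "W_char (take r1 \<mu>) = W1" by (simp add: W_char_def W1_def r min_def)
    moreover have "V_char (take r1 \<mu>) (\<lambda>_. 0) = V1" by (simp add: V_char_eq V1_def bs1_def)
    moreover have "box_quot d1 (boxes (take r1 \<mu>)) = A1"
      unfolding A1_def bs1_def by (rule box_quot_cong) (rule d1)
    ultimately show ?thesis by (simp add: T_vir_eq_S_quot G1_def)
  qed
  \<comment> \<open>Inside \<open>\<mu>\<close> the framings of the second factor are numbered from
    \<open>r1\<close>, in \<open>drop r1 \<mu>\<close> from 0.\<close>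
  have T2: "T_vir (drop r1 \<mu>) d2 = unshift_char r1 G2"
  proof -
    have "W_char (drop r1 \<mu>) = unshift_char r1 W2"
      by (simp add: W_char_def W2_def r unshift_sum unshift_monomial unshift_weight_pow_plane)
    moreover have "V_char (drop r1 \<mu>) (\<lambda>_. 0) = unshift_char r1 V2"
      by (simp add: V_char_eq V2_def bs2_def unshift_box_char)
    moreover have "box_quot d2 (boxes (drop r1 \<mu>)) = unshift_char r1 A2"
      by (simp add: A2_def bs2_def unshift_box_char d2)
    ultimately show ?thesis
      by (simp add: T_vir_eq_S_quot G2_def unshift_add unshift_S_pair unshift_S_quot)
  qed
  have bs1: "Framing (fst b) \<in> vars r" "fst b \<notin> {r1..<r}" if "b \<in> set bs1" for b
    using fst_less_length[of b "take r1 \<mu>"] that r by (simp_all add: bs1_def vars_def)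
  have bs2: "Framing (fst b) \<in> X2" "fst b \<in> {r1..<r}" if "b \<in> set bs2" for b
    using fst_less_length[of _ "drop r1 \<mu>"] that r
    by (force simp: bs2_def X2_def shift_box_def)+
  have X2: "X2 \<subseteq> vars r" by (auto simp: X2_def vars_def)
  have tX: "{T1, T2, Q} \<subseteq> vars r" "{T1, T2, Q} \<subseteq> X2" by (auto simp: X2_def vars_def)
  have g1: "graded r1 r (vars r) 0 W1" "graded r1 r (vars r) 0 V1" "graded r1 r (vars r) 0 A1"
  proof -
    show "graded r1 r (vars r) 0 W1"
      unfolding W1_def using r by (intro graded_sum graded_weight_pow) (auto simp: vars_def)
    show "graded r1 r (vars r) 0 V1" "graded r1 r (vars r) 0 A1"
      unfolding V1_def A1_def using bs1 by (auto intro!: graded_box_char tX)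
  qed
  have g2: "graded r1 r X2 1 W2" "graded r1 r X2 1 V2" "graded r1 r X2 1 A2"
  proof -
    show "graded r1 r X2 1 W2"
      unfolding W2_def using r by (intro graded_sum graded_weight_pow) (auto simp: X2_def)
    show "graded r1 r X2 1 V2" "graded r1 r X2 1 A2"
      unfolding V2_def A2_def using bs2 by (auto intro!: graded_box_char tX)
  qed
  note g2' = g2[THEN graded_mono, OF X2]
  have gG1: "graded r1 r (vars r) 0 G1"
    unfolding G1_def using graded_S_pair[OF tX(1) g1(1,2) g1(1,2)] graded_S_quot[OF tX(1) g1 g1]
    by (auto intro: graded_add)
  have gG2: "graded r1 r X2 0 G2"
    unfolding G2_def using graded_S_pair[OF tX(2) g2(1,2) g2(1,2)] graded_S_quot[OF tX(2) g2 g2]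
    by (auto intro: graded_add)
  have gG: "graded r1 r (vars r) 0 (G1 + G2)"
    by (rule graded_add[OF gG1 graded_mono[OF gG2 X2]])
  have gN: "graded r1 r (vars r) 1 N1" "graded r1 r (vars r) (-1) N2"
    unfolding N1_def N2_def using graded_S_pair[OF tX(1) g1(1,2) g2'(1,2)]
      graded_S_pair[OF tX(1) g2'(1,2) g1(1,2)] by auto
  have gM: "graded r1 r (vars r) 1 M1" "graded r1 r (vars r) (-1) M2"
    unfolding M1_def M2_def using graded_S_quot[OF tX(1) g1 g2'] graded_S_quot[OF tX(1) g2' g1] by auto
  have N: "normal_char r1 \<mu> = N1 + N2"
  proof (rule normal_char_eqI)
    show "tangent_char \<mu> = S_pair W1 V1 W1 V1 + S_pair W2 V2 W2 V2 + (N1 + N2)"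
      unfolding tangent_char_def S_char_eq W V S_pair_add N1_def N2_def ..
    show "C_degree r1 (length \<mu>) w = 0"
      if "w \<in> Poly_Mapping.keys (S_pair W1 V1 W1 V1 + S_pair W2 V2 W2 V2)" for w
    proof -
      have "graded r1 r (vars r) 0 (S_pair W1 V1 W1 V1 + S_pair W2 V2 W2 V2)"
        using graded_S_pair[OF tX(1) g1(1,2) g1(1,2)] graded_S_pair[OF tX(1) g2'(1,2) g2'(1,2)]
        by (auto intro: graded_add)
      with that show ?thesis by (simp add: graded_def r)
    qed
    show "C_degree r1 (length \<mu>) w \<noteq> 0" if "w \<in> Poly_Mapping.keys (N1 + N2)" for w
      using that keys_add[of N1 N2] gN unfolding graded_def r(2) by fastforce
  qed
  have p: "Poly_Mapping.keys p \<subseteq> vars r" "C_degree r1 r p = 0"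
  proof -
    have "graded r1 r (vars r) 0 (monomial p)"
      unfolding p_def monomial_add
      by (intro graded_mult[where c = 0 and c' = 0] graded_weight_pow) (auto simp: vars_def)
    then show "Poly_Mapping.keys p \<subseteq> vars r" "C_degree r1 r p = 0"
      by (simp_all add: graded_def monomial_def)
  qed
  have M2: "M2 = - (dual M1 * monomial (- p))"
  proof -
    have "- p = weight_pow Q (-1) + weight_pow T1 (-1) + weight_pow T2 (-1)"
      by (simp add: p_def weight_pow_def single_uminus)
    then have "monomial (- p) = q_inv * hbar_inv"
      by (simp add: q_inv_def hbar_inv_def monomial_add mult.assoc)
    then show ?thesis by (simp add: M1_def M2_def S_quot_swap[of W2 V2 A2])
  qed
  have rk: "char_rank M1 = int (r1 * total_degree (drop r1 \<mu>) d2) - int (r2 * total_degree (take r1 \<mu>) d1)"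
  proof -
    have "(\<Sum>b\<leftarrow>bs1. d b) = total_degree (take r1 \<mu>) d1"
      unfolding total_degree_def bs1_def using d1
      by (intro arg_cong[of _ _ sum_list] map_cong) auto
    moreover have "(\<Sum>b\<leftarrow>bs2. d b) = total_degree (drop r1 \<mu>) d2"
      by (simp add: total_degree_def bs2_def d2 comp_def)
    moreover have "char_rank W1 = int r1" "char_rank W2 = int r2"
      by (simp_all add: W1_def W2_def char_rank_sum char_rank_monomial)
    ultimately show ?thesis
      by (simp add: M1_def char_rank_S_quot A1_def A2_def char_rank_box_quot)
  qed
  have hp: "half_val u p = u Q * (u T1 * u T2)"
  proof -
    have nz: "u T1 \<noteq> 0" "u T2 \<noteq> 0" "u Q \<noteq> 0"
      using generic_nonzero[OF gen] by (auto simp: vars_def)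
    have "half_val u p = half_val u (weight_pow Q 1 + weight_pow T1 1) * half_val u (weight_pow T2 1)"
      unfolding p_def
      by (rule half_val_add)
        (use nz keys_weight_pow keys_add[of "weight_pow Q 1" "weight_pow T1 1"] in \<open>blast\<close>)
    also have "half_val u (weight_pow Q 1 + weight_pow T1 1)
        = half_val u (weight_pow Q 1) * half_val u (weight_pow T1 1)"
      by (rule half_val_add) (use nz keys_weight_pow in \<open>blast\<close>)
    finally show ?thesis by (simp add: half_val_weight_pow)
  qed
  have aG: "a_hat \<kappa> u (G1 + G2) = a_hat \<kappa> u (T_vir (take r1 \<mu>) d1) *
      a_hat \<kappa> (shift_framing r1 u) (T_vir (drop r1 \<mu>) d2)"
  proof -
    have nz: "a_hat_weight \<kappa> u w \<noteq> 0" if "w \<in> Poly_Mapping.keys G1 \<union> Poly_Mapping.keys G2" for w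
      using that gG1 graded_mono[OF gG2 X2] generic_a_hat_weight[OF gen _ \<kappa>, of w]
      unfolding graded_def by blast
    have "X2 \<subseteq> range (shift_var r1)"
    proof
      fix v assume "v \<in> X2"
      then have "v = shift_var r1 (case v of Framing k \<Rightarrow> Framing (k - r1) | _ \<Rightarrow> v)"
        by (auto simp: X2_def shift_var_def)
      then show "v \<in> range (shift_var r1)" by blast
    qed
    then have "a_hat \<kappa> (shift_framing r1 u) (unshift_char r1 G2) = a_hat \<kappa> u G2"
      using gG2 nz by (intro a_hat_unshift) (auto simp: graded_def)
    then show ?thesis using a_hat_add[of G1 G2 \<kappa> u, OF nz] by (simp add: T1 T2)
  qed
  have "((\<lambda>s. a_hat \<kappa> u (G1 + G2) * a_hat \<kappa> (?u s) (M1 - dual M1 * monomial (- p))) \<longlongrightarrow>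
      a_hat \<kappa> u (G1 + G2) * (- inverse (half_val u p)) powi char_rank M1) (at 0)"
    by (intro tendsto_mult tendsto_const tendsto_a_hat_split_framing[OF gen \<kappa> gM(1) p])
  \<comment> \<open>The factorization holds only near 0: \<open>a_hat\<close> is split into a
    product, and the normal part cancelled, where no factor vanishes.\<close>
  moreover have "\<forall>\<^sub>F s in at 0. a_hat \<kappa> u (G1 + G2) * a_hat \<kappa> (?u s) (M1 - dual M1 * monomial (- p))
      = inverse (a_hat \<kappa> (?u s) (normal_char r1 \<mu>)) * a_hat \<kappa> (?u s) (T_vir \<mu> d)"
    using eventually_neq_at_within[of 0]
      eventually_a_hat_weight_nonzero[OF gen \<kappa> gG, simplified]
      eventually_a_hat_weight_nonzero[OF gen \<kappa> gN(1), simplified]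
      eventually_a_hat_weight_nonzero[OF gen \<kappa> gN(2), simplified]
      eventually_a_hat_weight_nonzero[OF gen \<kappa> gM(1), simplified]
      eventually_a_hat_weight_nonzero[OF gen \<kappa> gM(2), simplified]
  proof eventually_elim
    case (elim s)
    have N': "a_hat_weight \<kappa> (?u s) w \<noteq> 0" if "w \<in> Poly_Mapping.keys (N1 + N2)" for w
      using that elim keys_add[of N1 N2] by blast
    have M': "a_hat_weight \<kappa> (?u s) w \<noteq> 0" if "w \<in> Poly_Mapping.keys (M1 + M2)" for w
      using that elim keys_add[of M1 M2] by blast
    have GN': "a_hat_weight \<kappa> (?u s) w \<noteq> 0" if "w \<in> Poly_Mapping.keys (G1 + G2 + (N1 + N2))" for w
      using that elim N' keys_add[of "G1 + G2" "N1 + N2"] by blast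
    have "a_hat \<kappa> (?u s) (T_vir \<mu> d) = a_hat \<kappa> (?u s) (G1 + G2 + (N1 + N2)) * a_hat \<kappa> (?u s) (M1 + M2)"
      unfolding T by (rule a_hat_add) (use GN' M' in blast)
    also have "a_hat \<kappa> (?u s) (G1 + G2 + (N1 + N2)) = a_hat \<kappa> (?u s) (G1 + G2) * a_hat \<kappa> (?u s) (N1 + N2)"
      by (rule a_hat_add) (use elim(2) N' in blast)
    also have "a_hat \<kappa> (?u s) (G1 + G2) = a_hat \<kappa> u (G1 + G2)"
      by (rule a_hat_split_framing_graded_0[OF gG elim(1)])
    finally show ?case
      using a_hat_nonzero[of "N1 + N2", OF N'] by (simp add: N M2)
  qed
  ultimately show ?thesis
    unfolding aG rk hp by (rule Lim_transform_eventually)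
qed

text \<open>Boxes of the first factor have constant values. Those of the second carry
  \<open>s^2\<close> and tend to 0, the default for missing variables; evaluation of a polynomial is
  continuous.\<close>

lemma tendsto_descendent_value:
  assumes r: "r1 \<le> length \<mu>"
    and d1: "\<And>b. b \<in> set (boxes (take r1 \<mu>)) \<Longrightarrow> d1 b = d b"
  shows "((\<lambda>s. descendent_value (split_framing r1 s u) \<tau> \<mu> d) \<longlongrightarrow>
    descendent_value u \<tau> (take r1 \<mu>) d1) (at 0)"
proof -
  let ?u = "\<lambda>s. split_framing r1 s u" and ?bs = "boxes (take r1 \<mu>)" and ?r = "length \<mu>"
  have lim: "((\<lambda>s. if i < length (boxes \<mu>) then half_val (?u s) (box_weight d (boxes \<mu> ! i)) ^ 2 else 0)
      \<longlongrightarrow> (if i < length ?bs then half_val u (box_weight d1 (?bs ! i)) ^ 2 else 0)) (at 0)" for i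
  proof -
    have w: "half_val (?u s) (box_weight d b)
        = s powi (if fst b \<in> {r1..<?r} then 1 else 0) * half_val u (box_weight d b)"
      if "s \<noteq> 0" "fst b < ?r" for s b
    proof -
      have "graded r1 ?r (vars ?r) (if fst b \<in> {r1..<?r} then 1 else 0) (monomial (box_weight d b))"
        using that by (intro graded_box_weight) (auto simp: vars_def)
      then show ?thesis
        using half_val_split_framing[OF that(1), of "box_weight d b" ?r r1 u]
        by (simp add: graded_def monomial_def)
    qed
    \<comment> \<open>The variable belongs to a box of the first factor, to one of the second, or to
      none.\<close>
    consider "i < length ?bs" | "length ?bs \<le> i" "i < length (boxes \<mu>)" | "length (boxes \<mu>) \<le> i"
      by linarith
    then show ?thesis
    proof cases
      case 1
      have b: "boxes \<mu> ! i = ?bs ! i" "i < length (boxes \<mu>)"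
        using 1 by (simp_all add: boxes_split[OF r] nth_append)
      have b1: "?bs ! i \<in> set ?bs" using 1 by simp
      then have "fst (?bs ! i) < r1" using fst_less_length[OF b1] r by simp
      moreover have "box_weight d1 (?bs ! i) = box_weight d (?bs ! i)"
        using d1[OF b1] by (simp add: box_weight_split[of d1] box_weight_split[of d])
      ultimately have "half_val u (box_weight d1 (?bs ! i)) ^ 2
          = half_val (?u s) (box_weight d (boxes \<mu> ! i)) ^ 2" if "s \<noteq> 0" for s
        using w[OF that, of "?bs ! i"] r by (simp add: b)
      then have "\<forall>\<^sub>F s in at 0. half_val u (box_weight d1 (?bs ! i)) ^ 2
          = half_val (?u s) (box_weight d (boxes \<mu> ! i)) ^ 2"
        by (auto intro: eventually_mono[OF eventually_neq_at_within[of 0]])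
      from Lim_transform_eventually[OF tendsto_const this] show ?thesis
        using 1 b by simp
    next
      case 2
      let ?b = "boxes \<mu> ! i"
      have "?b = shift_box r1 (boxes (drop r1 \<mu>) ! (i - length ?bs))"
        using 2 by (simp add: boxes_split[OF r] nth_append)
      then have b: "r1 \<le> fst ?b" by (simp add: shift_box_def split: prod.split)
      have "?b \<in> set (boxes \<mu>)" using 2 by simp
      then have b': "fst ?b < ?r" by (rule fst_less_length)
      have "((\<lambda>s. (s * half_val u (box_weight d ?b)) ^ 2) \<longlongrightarrow> (0 * half_val u (box_weight d ?b)) ^ 2) (at 0)"
        by (intro tendsto_intros)
      moreover have "\<forall>\<^sub>F s in at 0. (s * half_val u (box_weight d ?b)) ^ 2
          = half_val (?u s) (box_weight d ?b) ^ 2"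
        using w[OF _ b'] b b' by (intro eventually_mono[OF eventually_neq_at_within[of 0]]) simp
      ultimately have "((\<lambda>s. half_val (?u s) (box_weight d ?b) ^ 2)
          \<longlongrightarrow> (0 * half_val u (box_weight d ?b)) ^ 2) (at 0)"
        by (rule Lim_transform_eventually)
      then show ?thesis using 2 by simp
    next
      case 3
      then have "\<not> i < length ?bs" by (simp add: boxes_split[OF r])
      with 3 show ?thesis by simp
    qed
  qed
  show ?thesis
    unfolding descendent_value_def eval_poly_def by (intro tendsto_intros lim)
qed

lemma descendent_value_one: "descendent_value u 1 \<mu> d = 1"
  by (simp add: descendent_value_def eval_poly_def)


section \<open>Splitting the degrees\<close>

definition degrees :: "nat list list \<Rightarrow> nat \<Rightarrow> (box \<Rightarrow> nat) set" where
  "degrees \<mu> D = {d. stable \<mu> d \<and> total_degree \<mu> d = D}"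

text \<open>A stable degree vanishes off the boxes, and each value is bounded by the total.\<close>

lemma finite_degrees: "finite (degrees \<mu> D)"
proof (rule finite_subset)
  show "degrees \<mu> D \<subseteq> {d. \<forall>b. (b \<in> set (boxes \<mu>) \<longrightarrow> d b \<in> {..D}) \<and> (b \<notin> set (boxes \<mu>) \<longrightarrow> d b = 0)}"
    by (auto simp: degrees_def stable_def total_degree_def intro!: member_le_sum_list)
  show "finite {d. \<forall>b. (b \<in> set (boxes \<mu>) \<longrightarrow> d b \<in> {..D}) \<and> (b \<notin> set (boxes \<mu>) \<longrightarrow> d b = 0)}"
    by (rule finite_set_of_finite_funs) auto
qed

text \<open>The cutoff to 0 is forced by \<open>stable\<close>, which demands vanishing off the
  boxes of the first factor.\<close>

definition fst_degree :: "nat \<Rightarrow> (box \<Rightarrow> nat) \<Rightarrow> box \<Rightarrow> nat" where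
  "fst_degree r1 d = (\<lambda>b. if fst b < r1 then d b else 0)"

definition snd_degree :: "nat \<Rightarrow> (box \<Rightarrow> nat) \<Rightarrow> box \<Rightarrow> nat" where
  "snd_degree r1 d = (\<lambda>b. d (shift_box r1 b))"

definition join_degree :: "nat \<Rightarrow> (box \<Rightarrow> nat) \<Rightarrow> (box \<Rightarrow> nat) \<Rightarrow> box \<Rightarrow> nat" where
  "join_degree r1 d1 d2 = (\<lambda>(k, x, y). if k < r1 then d1 (k, x, y) else d2 (k - r1, x, y))"

context
  fixes r1 :: nat and \<mu> :: "nat list list"
  assumes r1: "r1 \<le> length \<mu>"
begin

lemma set_boxes_take: "(k, x, y) \<in> set (boxes (take r1 \<mu>)) \<longleftrightarrow> k < r1 \<and> (k, x, y) \<in> set (boxes \<mu>)"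
  using r1 by (auto simp: set_boxes)

lemma set_boxes_drop: "(k, x, y) \<in> set (boxes (drop r1 \<mu>)) \<longleftrightarrow> (r1 + k, x, y) \<in> set (boxes \<mu>)"
  using r1 by (auto simp: set_boxes)

lemma stable_fst: "stable \<mu> d \<Longrightarrow> stable (take r1 \<mu>) (fst_degree r1 d)"
  unfolding stable_def fst_degree_def by (auto simp: set_boxes_take)

lemma stable_snd: "stable \<mu> d \<Longrightarrow> stable (drop r1 \<mu>) (snd_degree r1 d)"
  unfolding stable_def snd_degree_def shift_box_def by (auto simp: set_boxes_drop)

text \<open>Stability compares boxes of one and the same partition only, so it can be checked on the
  two factors separately.\<close>

lemma stable_join:
  assumes d1: "stable (take r1 \<mu>) d1" and d2: "stable (drop r1 \<mu>) d2"
  shows "stable \<mu> (join_degree r1 d1 d2)"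
  unfolding stable_def
proof (intro conjI allI impI)
  fix b assume b: "b \<notin> set (boxes \<mu>)"
  obtain k x y where k: "b = (k, x, y)" by (cases b)
  show "join_degree r1 d1 d2 b = 0"
    using b d1 d2 set_boxes_take[of k x y] set_boxes_drop[of "k - r1" x y]
    unfolding stable_def k join_degree_def by auto
next
  fix k x y x' y'
  assume *: "(k, x', y') \<in> set (boxes \<mu>)" "x \<le> x'" "y \<le> y'"
  show "join_degree r1 d1 d2 (k, x', y') \<le> join_degree r1 d1 d2 (k, x, y)"
    using * d1 d2 set_boxes_take[of k x' y'] set_boxes_drop[of "k - r1" x' y']
    unfolding stable_def join_degree_def by auto
qed

lemma join_fst_snd: "join_degree r1 (fst_degree r1 d) (snd_degree r1 d) = d"
  by (auto simp: join_degree_def fst_degree_def snd_degree_def shift_box_def)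

text \<open>\<open>fst_degree\<close> discards all values from framing \<open>r1\<close> on;
  stability guarantees that they were 0 in \<open>d1\<close>.\<close>

lemma fst_join:
  assumes "stable (take r1 \<mu>) d1"
  shows "fst_degree r1 (join_degree r1 d1 d2) = d1"
  using assms by (auto simp: join_degree_def fst_degree_def stable_def set_boxes_take)

lemma snd_join: "snd_degree r1 (join_degree r1 d1 d2) = d2"
  by (auto simp: join_degree_def snd_degree_def shift_box_def)

lemma fst_degree_boxes: "b \<in> set (boxes (take r1 \<mu>)) \<Longrightarrow> fst_degree r1 d b = d b"
  by (cases b) (auto simp: fst_degree_def set_boxes_take)

lemma total_degree_split:
  "total_degree \<mu> d = total_degree (take r1 \<mu>) (fst_degree r1 d) + total_degree (drop r1 \<mu>) (snd_degree r1 d)"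
  by (simp add: total_degree_def boxes_split[OF r1] fst_degree_boxes snd_degree_def comp_def cong: map_cong)

text \<open>Degrees correspond bijectively to pairs of degrees of the factors. Sorting the pairs by
  the total degree of the first gives the shape of a Cauchy product of power series.\<close>

lemma sum_degrees_split:
  fixes f :: "(box \<Rightarrow> nat) \<Rightarrow> (box \<Rightarrow> nat) \<Rightarrow> complex"
  shows "(\<Sum>d\<in>degrees \<mu> D. f (fst_degree r1 d) (snd_degree r1 d))
    = (\<Sum>i=0..D. \<Sum>d1\<in>degrees (take r1 \<mu>) i. \<Sum>d2\<in>degrees (drop r1 \<mu>) (D - i). f d1 d2)"
proof -
  let ?S = "SIGMA i:{0..D}. degrees (take r1 \<mu>) i \<times> degrees (drop r1 \<mu>) (D - i)"
  have "(\<Sum>d\<in>degrees \<mu> D. f (fst_degree r1 d) (snd_degree r1 d))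
      = (\<Sum>(i, d1, d2)\<in>?S. f d1 d2)"
    by (rule sum.reindex_bij_witness[where
          i = "\<lambda>(i, d1, d2). join_degree r1 d1 d2" and
          j = "\<lambda>d. (total_degree (take r1 \<mu>) (fst_degree r1 d), fst_degree r1 d, snd_degree r1 d)"])
      (auto simp: degrees_def join_fst_snd fst_join snd_join stable_fst stable_snd stable_join
        total_degree_split)
  also have "\<dots> = (\<Sum>i=0..D. \<Sum>(d1, d2)\<in>degrees (take r1 \<mu>) i \<times> degrees (drop r1 \<mu>) (D - i). f d1 d2)"
    by (subst sum.Sigma) (auto simp: finite_degrees)
  finally show ?thesis by (simp add: sum.cartesian_product)
qed

end

text \<open>
  Collects the limit of the mixed part, the sign and the polarization: here \<open>x\<close> stands for
  \<open>\<hbar>\<^sup>1\<^sup>/\<^sup>2\<close> and \<open>q\<close> for \<open>q\<^sup>1\<^sup>/\<^sup>2\<close>.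
\<close>

lemma collect_prefactors:
  fixes q x :: complex
  assumes "q \<noteq> 0" "x \<noteq> 0"
  shows "(- inverse (q * x)) powi (int (r1 * j) - int (r2 * i)) *
      ((-1) ^ ((r1 + r2) * (i + j)) * q powi (- int ((r1 + r2) * (i + j))))
    = (x ^ r2) ^ i * ((-1) ^ (r1 * i) * q powi (- int (r1 * i))) *
      ((x powi (- int r1) * (q ^ 2) powi (- int r1)) ^ j * ((-1) ^ (r2 * j) * q powi (- int (r2 * j))))"
proof -
  let ?s = "\<lambda>n. (-1 :: complex) ^ n" and ?y = "inverse x" and ?p = "inverse q"
  \<comment> \<open>The four exponents stand for \<open>a = r1 * i\<close>,
    \<open>b = r1 * j\<close>, \<open>c = r2 * i\<close> and \<open>d = r2 * j\<close>.\<close>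
  have *: "(- inverse (q * x)) powi (int b - int c) * (?s (a + c + (b + d)) * q powi (- int (a + c + (b + d))))
      = x ^ c * (?s a * q powi (- int a)) * ((?y ^ b * (?p ^ 2) ^ b) * (?s d * q powi (- int d)))"
    for a b c d :: nat
  proof -
    have s: "inverse (?s n) = ?s n" for n by (simp add: power_inverse[symmetric])
    have "(- inverse (q * x)) powi (int b - int c) = (?s 1 * ?p * ?y) ^ b * inverse ((?s 1 * ?p * ?y) ^ c)"
      using assms by (subst power_int_diff) (simp_all add: divide_inverse mult.commute)
    also have "\<dots> = (?s b * ?p ^ b * ?y ^ b) * (?s c * q ^ c * x ^ c)"
      using s by (simp only: power_mult_distrib power_inverse inverse_mult_distrib inverse_inverse_eq
          power_one_right)
    finally have "(- inverse (q * x)) powi (int b - int c) *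
        (?s (a + c + (b + d)) * q powi (- int (a + c + (b + d))))
      = (?s b * ?p ^ b * ?y ^ b) * (?s c * q ^ c * x ^ c) *
        (?s a * ?s c * (?s b * ?s d) * (?p ^ a * ?p ^ c * (?p ^ b * ?p ^ d)))"
      by (simp only: power_int_minus power_int_of_nat power_add power_inverse inverse_mult_distrib)
    also have "\<dots> = (?s b * ?s b) * (?s c * ?s c) * (q ^ c * ?p ^ c) *
        (x ^ c * (?s a * ?p ^ a) * ((?y ^ b * (?p ^ b * ?p ^ b)) * (?s d * ?p ^ d)))"
      by (simp only: ac_simps)
    \<comment> \<open>The \<open>q ^ c\<close> from the limit cancels against the polarization,
      whereas \<open>?p ^ b\<close> occurs in both and is squared. This is why a power of
      \<open>q\<close> shifts \<open>z\<close> only in the second factor.\<close>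
    also have "(?s b * ?s b) * (?s c * ?s c) * (q ^ c * ?p ^ c) = 1"
      using assms by (simp add: power_inverse)
    finally show ?thesis
      by (simp add: power_int_minus power_inverse power2_eq_square power_mult_distrib)
  qed
  have "(r1 + r2) * (i + j) = r1 * i + r2 * i + (r1 * j + r2 * j)"
    by (simp add: algebra_simps)
  moreover have "(x ^ r2) ^ i = x ^ (r2 * i)"
    by (simp add: power_mult)
  moreover have "(x powi (- int r1) * (q ^ 2) powi (- int r1)) ^ j = ?y ^ (r1 * j) * (?p ^ 2) ^ (r1 * j)"
    by (simp add: power_int_minus power_mult_distrib power_inverse power_mult)
  ultimately show ?thesis by (simp only: *)
qed

section \<open>Factorization of the vertex coefficients\<close>

theorem theorem4:
  fixes n r r1 r2 :: nat
    and \<tau> :: mpoly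
    and u :: "var \<Rightarrow> complex"
    and \<kappa> :: complex
    and \<mu> :: "nat list list"
    and D :: nat
  assumes "r = r1 + r2"
    and "symmetric_poly n \<tau>"
    and "generic r u"
    and "\<kappa> \<noteq> 0"
    and "fixed_point n r \<mu>"
  shows "((\<lambda>s. fps_nth (restricted_vertex \<kappa> r1 (split_framing r1 s u) \<tau> \<mu>) D) \<longlongrightarrow>
           fps_nth
             (rescale ((u T1 * u T2) ^ r2)
                (vertex \<kappa> u \<tau> (take r1 \<mu>)) *
              rescale ((u T1 * u T2) powi (- int r1) * (u Q ^ 2) powi (- int r1))
                (vertex \<kappa> (shift_framing r1 u) 1 (drop r1 \<mu>))) D)
         (at 0)"
proof -
  have len: "length \<mu> = r" using assms(5) by (simp add: fixed_point_def)
  then have r1: "r1 \<le> length \<mu>" using assms(1) by simp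
  have nz: "u Q \<noteq> 0" "u T1 * u T2 \<noteq> 0"
    using generic_nonzero[OF assms(3)] by (auto simp: vars_def)
  let ?\<mu>1 = "take r1 \<mu>" and ?\<mu>2 = "drop r1 \<mu>" and ?u = "\<lambda>s. split_framing r1 s u"
  let ?x = "u T1 * u T2"
  \<comment> \<open>The limit of one summand, written through the two parts of its degree; the sign
    and the polarization are still those of the total degree \<open>D\<close>.\<close>
  define f where "f d1 d2 = a_hat \<kappa> u (T_vir ?\<mu>1 d1) * a_hat \<kappa> (shift_framing r1 u) (T_vir ?\<mu>2 d2) *
      (- inverse (u Q * ?x)) powi (int (r1 * total_degree ?\<mu>2 d2) - int (r2 * total_degree ?\<mu>1 d1)) *
      descendent_value u \<tau> ?\<mu>1 d1 * ((-1) ^ (r * D) * u Q powi (- int (r * D)))" for d1 d2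
  have uQ: "?u s Q = u Q" "shift_framing r1 u Q = u Q" for s
    by (simp_all add: split_framing_def shift_framing_def)
  have "fps_nth (restricted_vertex \<kappa> r1 (?u s) \<tau> \<mu>) D
      = (\<Sum>d\<in>degrees \<mu> D. inverse (a_hat \<kappa> (?u s) (normal_char r1 \<mu>)) * a_hat \<kappa> (?u s) (T_vir \<mu> d) *
          descendent_value (?u s) \<tau> \<mu> d * ((-1) ^ (r * D) * u Q powi (- int (r * D))))" for s
    by (simp add: restricted_vertex_def vertex_def degrees_def[symmetric] sum_distrib_left uQ len mult.assoc)
  \<comment> \<open>The index set does not depend on \<open>s\<close>, so the limit is taken
    termwise.\<close>
  moreover have "((\<lambda>s. \<Sum>d\<in>degrees \<mu> D. inverse (a_hat \<kappa> (?u s) (normal_char r1 \<mu>)) *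
        a_hat \<kappa> (?u s) (T_vir \<mu> d) *
        descendent_value (?u s) \<tau> \<mu> d * ((-1) ^ (r * D) * u Q powi (- int (r * D)))) \<longlongrightarrow>
      (\<Sum>d\<in>degrees \<mu> D. f (fst_degree r1 d) (snd_degree r1 d))) (at 0)"
    unfolding f_def
    by (intro tendsto_sum tendsto_mult tendsto_const
        tendsto_a_hat_T_vir[OF assms(3,4,1) len fst_degree_boxes[OF r1] snd_degree_def]
        tendsto_descendent_value[OF r1 fst_degree_boxes[OF r1]])
  moreover have "(\<Sum>d\<in>degrees \<mu> D. f (fst_degree r1 d) (snd_degree r1 d)) = fps_nth
             (rescale (?x ^ r2) (vertex \<kappa> u \<tau> ?\<mu>1) *
              rescale (?x powi (- int r1) * (u Q ^ 2) powi (- int r1))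
                (vertex \<kappa> (shift_framing r1 u) 1 ?\<mu>2)) D"
  proof -
    let ?c = "?x ^ r2" and ?c' = "?x powi (- int r1) * (u Q ^ 2) powi (- int r1)"
    \<comment> \<open>With the total degrees fixed as \<open>i\<close> and \<open>D - i\<close>, the
      prefactors split according to \<open>collect_prefactors\<close> for
      \<open>j = D - i\<close>.\<close>
    have f: "f d1 d2 = (?c ^ i * (a_hat \<kappa> u (T_vir ?\<mu>1 d1) * descendent_value u \<tau> ?\<mu>1 d1 *
          (-1) ^ (r1 * i) * u Q powi (- int (r1 * i)))) *
        (?c' ^ (D - i) * (a_hat \<kappa> (shift_framing r1 u) (T_vir ?\<mu>2 d2) * (-1) ^ (r2 * (D - i)) *
          u Q powi (- int (r2 * (D - i)))))"
      if "i \<in> {0..D}" "d1 \<in> degrees ?\<mu>1 i" "d2 \<in> degrees ?\<mu>2 (D - i)" for i d1 d2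
    proof -
      have "f d1 d2 = a_hat \<kappa> u (T_vir ?\<mu>1 d1) * a_hat \<kappa> (shift_framing r1 u) (T_vir ?\<mu>2 d2) *
          descendent_value u \<tau> ?\<mu>1 d1 *
          ((- inverse (u Q * ?x)) powi (int (r1 * (D - i)) - int (r2 * i)) *
            ((-1) ^ ((r1 + r2) * (i + (D - i))) * u Q powi (- int ((r1 + r2) * (i + (D - i))))))"
        using that by (simp add: f_def degrees_def assms(1))
      then show ?thesis
        unfolding collect_prefactors[OF nz] by (simp only: ac_simps)
    qed
    have v: "fps_nth (rescale ?c (vertex \<kappa> u \<tau> ?\<mu>1)) i = (\<Sum>d1\<in>degrees ?\<mu>1 i.
        ?c ^ i * (a_hat \<kappa> u (T_vir ?\<mu>1 d1) * descendent_value u \<tau> ?\<mu>1 d1 *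
          (-1) ^ (r1 * i) * u Q powi (- int (r1 * i))))" for i
      using r1 by (simp add: rescale_def vertex_def degrees_def[symmetric] sum_distrib_left min_def)
    have v': "fps_nth (rescale ?c' (vertex \<kappa> (shift_framing r1 u) 1 ?\<mu>2)) j = (\<Sum>d2\<in>degrees ?\<mu>2 j.
        ?c' ^ j * (a_hat \<kappa> (shift_framing r1 u) (T_vir ?\<mu>2 d2) *
          (-1) ^ (r2 * j) * u Q powi (- int (r2 * j))))" for j
      by (simp add: rescale_def vertex_def degrees_def[symmetric] sum_distrib_left uQ len assms(1)
          descendent_value_one)
    show ?thesis
      unfolding sum_degrees_split[OF r1] fps_mult_nth v v' sum_product
      by (intro sum.cong refl f)
  qed
  ultimately show ?thesis by simp
qed

end
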